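(* Let $(Y,\mathcal{C},\nu,T)$ be an ergodic, infinite measure-preserving system. Let $\alpha_0$ be a finite partition of $Y$ and let $0<\epsilon<1$. Then there exists a finite partition $\alpha$ of $Y$ (with the same number of atoms as $\alpha_0$) such that (1) $d(\alpha_0,\alpha)<\epsilon$; (2) $\alpha$ is uniform relative to $K_\alpha$; (3) for every $x\in X_\alpha$, the orbit of $x$ under the shift $S_\alpha$ meets $\{x'\in X_\alpha: x'_0\neq 1\}$ in infinitely many points.
   Context: All relations among measurable sets and all properties of maps between measure spaces are understood up to sets of measure zero. A non-atomic, infinite Lebesgue space is a measure space isomorphic to $\mathbb{R}$ with Lebesgue measurable sets and Lebesgue measure. An infinite measure-preserving system $(Y,\mathcal{C},\nu,T)$ is a non-atomic, infinite Lebesgue space with a bijection $T:Y\to Y$ such that $T,T^{-1}$ are measurable and $\nu(T^{-1}E)=\nu(E)$ for all $E\in\mathcal{C}$; it is ergodic if every $T$-invariant $B\in\mathcal{C}$ has $\nu(B)=0$ or $\nu(Y\setminus B)=0$. Let $\mathcal{C}_0=\{C\in\mathcal{C}:0<\nu(C)<\infty\}$. A finite partition of $Y$ is a measurable partition $\alpha=\{A_1,\dots,A_N\}$, $N\ge2$, with a unique atom of infinite measure, always indexed so that $\nu(A_1)=\infty$; put $K_\alpha=Y\setminus A_1$, with $\nu(K_\alpha)>0$, so that $K_\alpha\in\mathcal{C}_0$. For finite partitions $\alpha=\{A_1,\dots,A_N\}$, $\beta=\{B_1,\dots,B_N\}$ set $d(\alpha,\beta)=\sum_{i\ne1}\nu(A_i\triangle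 B_i)$. The join is $\alpha\vee\beta=\{A\cap B:A\in\alpha,B\in\beta\}$, and $\alpha_m^n=\bigvee_{i=m}^nT^{-i}\alpha$ for $m\le n$. For a function $f$ on $Y$, $T_Nf=\sum_{i=-N}^{N-1}f\circ T^i$. A set $C\in\mathcal{C}_0$ is uniform relative to $K\in\mathcal{C}_0$ if for every $\epsilon>0$ there is $m\in\mathbb{N}$ such that for a.e. $y\in K$ and all $N\in\mathbb{N}$, $T_N\mathbf{1}_K(y)\ge m$ implies $\left|\frac{T_N\mathbf{1}_C(y)}{T_N\mathbf{1}_K(y)}-\frac{\nu(C)}{\nu(K)}\right|<\epsilon$. A finite partition $\alpha$ is uniform relative to $K$ if all sets (of positive and) finite measure in $\bigcup_{n\in\mathbb{N}}\alpha_{-n}^{n-1}$ are uniform relative to $K$. Symbolic factor: define $\phi_\alpha:Y\to\{1,\dots,N\}^{\mathbb{Z}}$ by $T^iy\in A_{\phi_\alpha(y)_i}$ for all $i\in\mathbb{Z}$. Let $\hat\mu_\alpha=\nu\circ\phi_\alpha^{-1}$ and let $\hat X_\alpha$ be its support (smallest closed set of full measure); equivalently $x\in\hat X_\alpha$ iff every finite word $w_1\cdots w_n$ occurring in $x$ satisfies $\nu(\bigcap_{i=1}^nT^{-(i-1)}A_{w_i})>0$. Let $1^\infty$ be the constant sequence $1$ (which lies in $\hat X_\alpha$), $X_\alpha=\hat X_\alpha\setminus\{1^\infty\}$, and $S_\alpha$ the restriction of the left shift to $X_\alpha$. *)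

theory Defs
  imports "HOL-Analysis.Analysis"
begin

definition measure_iso :: "'a measure \<Rightarrow> 'b measure \<Rightarrow> ('a \<Rightarrow> 'b) \<Rightarrow> bool" where
  "measure_iso M N f \<longleftrightarrow>
     bij_betw f (space M) (space N) \<and>
     f \<in> M \<rightarrow>\<^sub>M N \<and> inv_into (space M) f \<in> N \<rightarrow>\<^sub>M M \<and>
     (\<forall>E\<in>sets N. emeasure M (f -` E \<inter> space M) = emeasure N E)"

text \<open>
  The isomorphism with the real line is only required off null sets. Since this says nothing about
  the subsets of the discarded null set, completeness (which holds for the Lebesgue
  \<open>\<sigma>\<close>-algebra) is required separately.
\<close>

definition infinite_lebesgue_space :: "'a measure \<Rightarrow> bool" where
  "infinite_lebesgue_space M \<longleftrightarrow>
     complete_measure M \<and>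
     (\<exists>A\<in>null_sets M. \<exists>B\<in>null_sets (lebesgue :: real measure). \<exists>f.
        measure_iso (restrict_space M (space M - A)) (restrict_space lebesgue (- B)) f)"

definition infinite_mps :: "'a measure \<Rightarrow> ('a \<Rightarrow> 'a) \<Rightarrow> bool" where
  "infinite_mps M T \<longleftrightarrow> infinite_lebesgue_space M \<and> measure_iso M M T"

definition ergodic_mps :: "'a measure \<Rightarrow> ('a \<Rightarrow> 'a) \<Rightarrow> bool" where
  "ergodic_mps M T \<longleftrightarrow>
     (\<forall>B\<in>sets M. sym_diff (T -` B \<inter> space M) B \<in> null_sets M \<longrightarrow>
        emeasure M B = 0 \<or> emeasure M (space M - B) = 0)"

definition pos_fin_sets :: "'a measure \<Rightarrow> 'a set set" where
  "pos_fin_sets M = {C \<in> sets M. 0 < emeasure M C \<and> emeasure M C < \<infinity>}"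

definition iter_int :: "'a set \<Rightarrow> ('a \<Rightarrow> 'a) \<Rightarrow> int \<Rightarrow> 'a \<Rightarrow> 'a" where
  "iter_int Y T i = (if 0 \<le> i then T ^^ nat i else inv_into Y T ^^ nat (- i))"

text \<open>
  A partition is given by its atoms \<open>\<alpha> 1, \<dots>, \<alpha> N\<close>; the values of \<open>\<alpha>\<close> at other indices are
  irrelevant. An atom may have measure zero as long as the union of the finite-measure atoms
  does not.
\<close>

definition fin_core :: "'a measure \<Rightarrow> (nat \<Rightarrow> 'a set) \<Rightarrow> 'a set" where
  "fin_core M \<alpha> = space M - \<alpha> 1"

definition finite_partition :: "'a measure \<Rightarrow> nat \<Rightarrow> (nat \<Rightarrow> 'a set) \<Rightarrow> bool" where
  "finite_partition M N \<alpha> \<longleftrightarrow>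
     2 \<le> N \<and>
     (\<forall>i\<in>{1..N}. \<alpha> i \<in> sets M \<and> \<alpha> i \<noteq> {}) \<and>
     disjoint_family_on \<alpha> {1..N} \<and> (\<Union>i\<in>{1..N}. \<alpha> i) = space M \<and>
     emeasure M (\<alpha> 1) = \<infinity> \<and> (\<forall>i\<in>{1..N} - {1}. emeasure M (\<alpha> i) < \<infinity>) \<and>
     0 < emeasure M (fin_core M \<alpha>)"

definition part_dist :: "'a measure \<Rightarrow> nat \<Rightarrow> (nat \<Rightarrow> 'a set) \<Rightarrow> (nat \<Rightarrow> 'a set) \<Rightarrow> ennreal" where
  "part_dist M N \<alpha> \<beta> = (\<Sum>i\<in>{1..N} - {1}. emeasure M (sym_diff (\<alpha> i) (\<beta> i)))"

text \<open>
  The iterated join of the \<open>T\<^sup>-\<^sup>i \<alpha>\<close>, \<open>m \<le> i \<le> n\<close>; only used for \<open>m \<le> n\<close> (the empty intersection would be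
  the whole type, not \<open>space M\<close>).
\<close>

definition part_join ::
  "'a measure \<Rightarrow> ('a \<Rightarrow> 'a) \<Rightarrow> nat \<Rightarrow> (nat \<Rightarrow> 'a set) \<Rightarrow> int \<Rightarrow> int \<Rightarrow> 'a set set" where
  "part_join M T N \<alpha> m n =
     {(\<Inter>i\<in>{m..n}. iter_int (space M) T i -` A i \<inter> space M) | A. \<forall>i\<in>{m..n}. A i \<in> \<alpha> ` {1..N}}"

definition birkhoff_sum ::
  "'a measure \<Rightarrow> ('a \<Rightarrow> 'a) \<Rightarrow> nat \<Rightarrow> ('a \<Rightarrow> real) \<Rightarrow> 'a \<Rightarrow> real" where
  "birkhoff_sum M T n f y = (\<Sum>i\<in>{- int n..int n - 1}. f (iter_int (space M) T i y))"

text \<open>\<open>C\<close> is uniform relative to \<open>K\<close>. The bound \<open>m\<close> is positive, so the denominator below is never zero.\<close>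

definition uniform_set :: "'a measure \<Rightarrow> ('a \<Rightarrow> 'a) \<Rightarrow> 'a set \<Rightarrow> 'a set \<Rightarrow> bool" where
  "uniform_set M T K C \<longleftrightarrow>
     K \<in> pos_fin_sets M \<and> C \<in> pos_fin_sets M \<and>
     (\<forall>\<epsilon>>0. \<exists>m::nat. 0 < m \<and>
        (AE y in M. y \<in> K \<longrightarrow>
          (\<forall>n. birkhoff_sum M T n (indicator K) y \<ge> real m \<longrightarrow>
             \<bar>birkhoff_sum M T n (indicator C) y / birkhoff_sum M T n (indicator K) y
               - measure M C / measure M K\<bar> < \<epsilon>)))"

definition uniform_partition ::
  "'a measure \<Rightarrow> ('a \<Rightarrow> 'a) \<Rightarrow> nat \<Rightarrow> (nat \<Rightarrow> 'a set) \<Rightarrow> 'a set \<Rightarrow> bool" where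
  "uniform_partition M T N \<alpha> K \<longleftrightarrow>
     (\<forall>n\<ge>1. \<forall>C\<in>part_join M T N \<alpha> (- int n) (int n - 1).
        C \<in> pos_fin_sets M \<longrightarrow> uniform_set M T K C)"

text \<open>
  Bi-infinite sequences carry the product topology of the type \<open>int \<Rightarrow> nat\<close> (with \<open>nat\<close> discrete),
  in which the sequences over \<open>{1..N}\<close> form a compact, hence closed, subset.
\<close>

definition itinerary ::
  "'a measure \<Rightarrow> ('a \<Rightarrow> 'a) \<Rightarrow> nat \<Rightarrow> (nat \<Rightarrow> 'a set) \<Rightarrow> 'a \<Rightarrow> int \<Rightarrow> nat" where
  "itinerary M T N \<alpha> y = (\<lambda>i. THE j. j \<in> {1..N} \<and> iter_int (space M) T i y \<in> \<alpha> j)"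

definition symbolic_measure ::
  "'a measure \<Rightarrow> ('a \<Rightarrow> 'a) \<Rightarrow> nat \<Rightarrow> (nat \<Rightarrow> 'a set) \<Rightarrow> (int \<Rightarrow> nat) measure" where
  "symbolic_measure M T N \<alpha> = distr M borel (itinerary M T N \<alpha>)"

definition measure_support :: "'b::topological_space measure \<Rightarrow> 'b set" where
  "measure_support \<mu> = \<Inter>{F. closed F \<and> emeasure \<mu> (- F) = 0}"

definition symbolic_space ::
  "'a measure \<Rightarrow> ('a \<Rightarrow> 'a) \<Rightarrow> nat \<Rightarrow> (nat \<Rightarrow> 'a set) \<Rightarrow> (int \<Rightarrow> nat) set" where
  "symbolic_space M T N \<alpha> = measure_support (symbolic_measure M T N \<alpha>) - {\<lambda>_. 1}"

definition left_shift :: "(int \<Rightarrow> 'b) \<Rightarrow> int \<Rightarrow> 'b" where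
  "left_shift x = (\<lambda>i. x (i + 1))"

definition full_orbit :: "'a set \<Rightarrow> ('a \<Rightarrow> 'a) \<Rightarrow> 'a \<Rightarrow> 'a set" where
  "full_orbit X S x = {iter_int X S k x | k. True}"

end

theory Submission
  imports Defs
begin

text \<open>
  The partition \<open>\<alpha>\<close> arises from \<open>\<alpha>\<^sub>0\<close> by erasing only: a small part of \<open>K\<^sub>0 = Y - \<alpha>\<^sub>0 1\<close> is moved to the
  infinite atom. Choose a cut set \<open>F\<close> inside the set of points whose long forward orbit segments
  have the right frequencies of words relative to visits to \<open>K\<^sub>0\<close> (ratio ergodic theorem), with all
  return times to \<open>F\<close> large; then every column between two visits to \<open>F\<close> has good frequencies.
  Erasing all columns longer than a large bound \<open>L\<close> costs little measure, since columns are almost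
  surely finite, and after that every remaining column is good and short. Iterating with cut sets
  \<open>F\<^sub>1 \<supseteq> F\<^sub>2 \<supseteq> \<dots>\<close>, later erasures remove or keep whole earlier columns, so the good frequencies
  persist and the limit partition is uniform. Moreover each point of the limit set \<open>K\<close> visits \<open>K\<close>
  at least \<open>m\<close> times within a time bounded in terms of \<open>m\<close> only, which forces every point of \<open>X\<close> to
  have infinitely many letters different from 1; together with uniformity, which excludes periodic
  points, this is the orbit condition.
\<close>

text \<open>In infinite measure frequencies make sense only relative to visits, and erasing changes
  both the visited set and the words that are read. So each stage applies the ratio theorem afresh,
  to the current set \<open>K k\<close> and to all words in windows of radius \<open>k\<close> with
  a letter other than 1 at time 0; these cylinders have finite measure. The frequencies aimed at
  thus vary with \<open>k\<close>, and they converge to those of the limit set. Two errors are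
  controlled pointwise instead of by averaging. A window that sticks out of its column may change
  when neighbouring columns are erased; hence every column must contain many visits compared with
  \<open>k\<close>. An orbit segment also begins and ends inside columns, and good frequencies over
  a whole column say nothing about a piece of it. This is why long columns are erased: an incomplete
  column then costs at most \<open>L\<close>, and the number of visits demanded by uniformity may
  depend on \<open>L\<close>.\<close>

lemma iter_int_0 [simp]: "iter_int Y T 0 = id"
  by (simp add: iter_int_def)

lemma iter_int_step:
  assumes "bij_betw T Y Y" "y \<in> Y"
  shows "iter_int Y T i y \<in> Y" "iter_int Y T (i + 1) y = T (iter_int Y T i y)"
proof -
  let ?U = "inv_into Y T"
  have T: "T z \<in> Y" "?U z \<in> Y" "T (?U z) = z" if "z \<in> Y" for z
    using assms(1) that bij_betw_inv_into[OF assms(1)]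
    by (auto simp: bij_betw_def f_inv_into_f inv_into_into)
  have p: "(T ^^ n) y \<in> Y" "(?U ^^ n) y \<in> Y" for n
    by (induction n) (use assms(2) T in auto)
  show "iter_int Y T i y \<in> Y"
    using p by (simp add: iter_int_def)
  show "iter_int Y T (i + 1) y = T (iter_int Y T i y)"
  proof (cases "0 \<le> i")
    case True
    then show ?thesis by (simp add: iter_int_def nat_add_distrib)
  next
    case False
    then obtain n where n: "i = - int (Suc n)"
      by (metis not_le int_cases of_nat_0_le_iff)
    have 1: "iter_int Y T i y = ?U ((?U ^^ n) y)"
      using n by (simp add: iter_int_def nat_add_distrib)
    have "iter_int Y T (i + 1) y = (?U ^^ n) y"
      using n by (cases n) (simp_all add: iter_int_def nat_add_distrib)
    then show ?thesis
      using 1 T(3) p(2) by simp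
  qed
qed

lemma iter_int_add:
  assumes "bij_betw T Y Y" "y \<in> Y"
  shows "iter_int Y T (i + j) y = iter_int Y T i (iter_int Y T j y)"
proof -
  have inj: "T a = T b \<Longrightarrow> a \<in> Y \<Longrightarrow> b \<in> Y \<Longrightarrow> a = b" for a b
    using assms(1) by (auto simp: bij_betw_def inj_on_def)
  note st = iter_int_step[OF assms(1)]
  show ?thesis
  proof (induction i rule: int_induct[where k = 0])
    case base
    then show ?case by simp
  next
    case (step1 i)
    then show ?case
      using st[OF assms(2)] st[OF st(1)[OF assms(2)]] by (metis add.assoc add.commute)
  next
    case (step2 i)
    \<comment> \<open>Going down, the two sides have equal images under \<open>T\<close>, which is
      injective.\<close>
    have "i - 1 + j + 1 = i + j" by simp
    then have "T (iter_int Y T (i - 1 + j) y) = T (iter_int Y T (i - 1) (iter_int Y T j y))"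
      using step2(2) st(2)[OF assms(2), of "i - 1 + j"] st(2)[OF st(1)[OF assms(2), of j], of "i - 1"]
      by (metis diff_add_cancel)
    then show ?case
      using st(1)[OF assms(2)] st(1)[OF st(1)[OF assms(2)]] by (intro inj[of "iter_int Y T (i - 1 + j) y"]) auto
  qed
qed

text \<open>Of the Lebesgue structure only infinite total measure and \<open>splits\<close>, a form
  of non-atomicity, are kept. The latter rules out systems such as the translation of the integers,
  which is ergodic but never returns.\<close>

locale ergodic_infinite =
  fixes M :: "'a measure" and T :: "'a \<Rightarrow> 'a"
  assumes bij: "bij_betw T (space M) (space M)"
    and meas [measurable]: "T \<in> M \<rightarrow>\<^sub>M M"
    and meas_inv [measurable]: "inv_into (space M) T \<in> M \<rightarrow>\<^sub>M M"
    and preserve: "A \<in> sets M \<Longrightarrow> emeasure M (T -` A \<inter> space M) = emeasure M A"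
    and erg: "ergodic_mps M T"
    and inf_space: "emeasure M (space M) = \<infinity>"
    and splits: "W \<in> sets M \<Longrightarrow> emeasure M W > 0 \<Longrightarrow>
      \<exists>V\<in>sets M. V \<subseteq> W \<and> emeasure M V > 0 \<and> emeasure M (W - V) > 0"
begin

abbreviation "tt \<equiv> iter_int (space M) T"

lemmas tt_space [intro, simp] = iter_int_step(1)[OF bij]
lemmas tt_add = iter_int_add[OF bij]

lemma tt_1: "y \<in> space M \<Longrightarrow> tt 1 y = T y"
  using iter_int_step(2)[OF bij, of y 0] by simp

lemma tt_Suc: "y \<in> space M \<Longrightarrow> tt (1 + i) y = tt i (T y)"
  using tt_add[of y i 1] by (simp add: tt_1 add.commute)

lemma tt_measurable [measurable]: "tt i \<in> M \<rightarrow>\<^sub>M M"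
proof -
  have "T ^^ n \<in> M \<rightarrow>\<^sub>M M" "inv_into (space M) T ^^ n \<in> M \<rightarrow>\<^sub>M M" for n
    by (induction n) (auto simp: comp_def)
  then show ?thesis by (simp add: iter_int_def)
qed

lemma tt_preserve:
  assumes A: "A \<in> sets M"
  shows "emeasure M (tt i -` A \<inter> space M) = emeasure M A"
proof (induction i rule: int_induct[where k = 0])
  case base
  then show ?case using sets.sets_into_space[OF A] by (simp add: Int_absorb2)
next
  have *: "emeasure M (tt (i + 1) -` A \<inter> space M) = emeasure M (tt i -` A \<inter> space M)" for i
  proof -
    have "tt (i + 1) -` A \<inter> space M = T -` (tt i -` A \<inter> space M) \<inter> space M"
      using tt_Suc[of _ i] measurable_space[OF meas] by (subst add.commute) auto
    then show ?thesis
      using A by (metis preserve measurable_sets tt_measurable)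
  qed
  {
    case (step1 i)
    then show ?case using * by simp
  next
    case (step2 i)
    then show ?case using *[of "i - 1"] by simp
  }
qed

section \<open>Invariant sets, recurrence and marker sets\<close>

lemma AE_tt:
  assumes "AE y in M. P y"
  shows "AE y in M. \<forall>i. P (tt i y)"
proof -
  obtain N where N: "N \<in> null_sets M" "{y \<in> space M. \<not> P y} \<subseteq> N"
    using assms by (auto elim!: AE_E3)
  have "tt i -` N \<inter> space M \<in> null_sets M" for i
    using N(1) tt_preserve[of N i] by (auto simp: null_sets_def)
  then have "AE y in M. y \<notin> tt i -` N \<inter> space M" for i
    by (rule AE_not_in)
  then have "AE y in M. \<forall>i. y \<notin> tt i -` N \<inter> space M"
    by (simp add: AE_all_countable)
  then show ?thesis
    using AE_space
  proof eventually_elim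
    case (elim y)
    then show ?case using N(2) by auto
  qed
qed

lemma AE_invariant_cases:
  assumes [measurable]: "B \<in> sets M" and inv: "\<And>y. y \<in> space M \<Longrightarrow> T y \<in> B \<longleftrightarrow> y \<in> B"
  shows "(AE y in M. y \<notin> B) \<or> (AE y in M. y \<in> B)"
proof -
  have eq: "T -` B \<inter> space M = B"
    using inv sets.sets_into_space[OF assms(1)] by auto
  have "emeasure M B = 0 \<or> emeasure M (space M - B) = 0"
    using erg assms(1) unfolding ergodic_mps_def by (auto simp: eq)
  then show ?thesis
  proof
    assume "emeasure M B = 0"
    then show ?thesis by (intro disjI1 AE_not_in) auto
  next
    assume "emeasure M (space M - B) = 0"
    then have "AE y in M. y \<notin> space M - B"
      by (intro AE_not_in) auto
    then show ?thesis by auto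
  qed
qed

text \<open>The points whose orbit meets \<open>A\<close> form an invariant set that contains
  \<open>A\<close>, so it cannot be the null alternative of ergodicity.\<close>

lemma AE_visit:
  assumes [measurable]: "A \<in> sets M" and pos: "emeasure M A > 0"
  shows "AE y in M. \<exists>i. tt i y \<in> A"
proof -
  define B where "B = {y \<in> space M. \<exists>i. tt i y \<in> A}"
  have [measurable]: "B \<in> sets M" unfolding B_def by measurable
  have "T y \<in> B \<longleftrightarrow> y \<in> B" if "y \<in> space M" for y
  proof -
    have "(\<exists>i. tt i (T y) \<in> A) \<longleftrightarrow> (\<exists>i. tt (1 + i) y \<in> A)"
      using that by (simp add: tt_Suc)
    also have "\<dots> \<longleftrightarrow> (\<exists>i. tt i y \<in> A)"
      by (metis add_diff_cancel_left' diff_add_cancel add.commute)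
    finally show ?thesis
      using that measurable_space[OF meas] by (auto simp: B_def)
  qed
  then have "(AE y in M. y \<notin> B) \<or> (AE y in M. y \<in> B)"
    by (intro AE_invariant_cases) auto
  moreover have "\<not> (AE y in M. y \<notin> B)"
  proof
    assume "AE y in M. y \<notin> B"
    then have "AE y in M. y \<notin> A"
      using AE_space
    proof eventually_elim
      case (elim y)
      then have "tt 0 y \<notin> A" unfolding B_def by blast
      then show ?case by simp
    qed
    then have "emeasure M A = 0"
      using AE_iff_null_sets[OF assms(1)] by auto
    with pos show False by simp
  qed
  ultimately show ?thesis by (auto simp: B_def)
qed

text \<open>Otherwise split \<open>W\<close> into two parts of positive measure. Almost every orbit
  meets \<open>V\<close>, so a point of \<open>W - V\<close> would return to \<open>W\<close> at a
  nonzero time.\<close>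

lemma wandering_null:
  assumes [measurable]: "W \<in> sets M"
    and wander: "\<And>y i. y \<in> W \<Longrightarrow> i \<noteq> 0 \<Longrightarrow> tt i y \<notin> W"
  shows "emeasure M W = 0"
proof (rule ccontr)
  assume "emeasure M W \<noteq> 0"
  then obtain V where V: "V \<in> sets M" "V \<subseteq> W" "emeasure M V > 0" "emeasure M (W - V) > 0"
    using splits[of W] by (auto simp: zero_less_iff_neq_zero)
  have "AE y in M. y \<notin> W - V"
    using AE_visit[OF V(1,3)]
  proof eventually_elim
    case (elim y)
    then obtain i where "tt i y \<in> V" by blast
    then show ?case using wander[of y i] V(2) by (cases "i = 0") auto
  qed
  then have "emeasure M (W - V) = 0"
    using V(1) AE_iff_null_sets[of "W - V" M] by auto
  with V(4) show False by simp
qed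

text \<open>Infinite measure gives no Poincare recurrence for free. But an orbit makes at most one
  last and at most one first visit to \<open>A\<close>, so the points of last visit
  (\<open>W1\<close>) and of first visit (\<open>W2\<close>) form wandering sets and are null. From
  one visit further ones are then found in both directions.\<close>

lemma AE_recurrent:
  assumes [measurable]: "A \<in> sets M" and pos: "emeasure M A > 0"
  shows "AE y in M. \<forall>i. (\<exists>j>i. tt j y \<in> A) \<and> (\<exists>j<i. tt j y \<in> A)"
proof -
  define W1 where "W1 = {y \<in> A. \<forall>i. 0 < i \<longrightarrow> tt i y \<notin> A}"
  define W2 where "W2 = {y \<in> A. \<forall>i. i < 0 \<longrightarrow> tt i y \<notin> A}"
  have sp: "y \<in> A \<Longrightarrow> y \<in> space M" for y
    using sets.sets_into_space[OF assms(1)] by auto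
  have ret: "tt (- i) (tt i y) = y" if "y \<in> space M" for y i
    using tt_add[OF that, of "- i" i] by simp
  have [measurable]: "W1 \<in> sets M" "W2 \<in> sets M" unfolding W1_def W2_def by measurable
  have "emeasure M W1 = 0"
  proof (rule wandering_null, goal_cases)
    case (2 y i)
    have "y \<in> A" using 2 by (simp add: W1_def)
    have False if "tt i y \<in> W1" "i < 0"
    proof -
      have "tt (- i) (tt i y) \<notin> A" using that unfolding W1_def by force
      then show False using ret[OF sp] \<open>y \<in> A\<close> by simp
    qed
    moreover have "tt i y \<notin> W1" if "0 < i" using 2 that by (simp add: W1_def)
    ultimately show ?case using 2 by (meson linorder_neqE)
  qed simp
  moreover have "emeasure M W2 = 0"
  proof (rule wandering_null, goal_cases)
    case (2 y i)
    have "y \<in> A" using 2 by (simp add: W2_def)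
    have False if "tt i y \<in> W2" "0 < i"
    proof -
      have "tt (- i) (tt i y) \<notin> A" using that unfolding W2_def by force
      then show False using ret[OF sp] \<open>y \<in> A\<close> by simp
    qed
    moreover have "tt i y \<notin> W2" if "i < 0" using 2 that by (simp add: W2_def)
    ultimately show ?case using 2 by (meson linorder_neqE)
  qed simp
  ultimately have "AE y in M. y \<notin> W1" "AE y in M. y \<notin> W2"
    by (auto intro!: AE_not_in)
  from AE_tt[OF this(1)] AE_tt[OF this(2)] AE_visit[OF assms] AE_space
  show ?thesis
  proof eventually_elim
    case (elim y)
    obtain i0 where i0: "tt i0 y \<in> A" using elim by blast
    have up: "\<exists>j>i. tt j y \<in> A" if hit: "tt i y \<in> A" for i
    proof -
      have "tt i y \<notin> W1" using elim by blast
      then obtain k where "0 < k" "tt k (tt i y) \<in> A" using hit by (auto simp: W1_def)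
      then have "tt (k + i) y \<in> A" using tt_add[of y k i] elim by simp
      then show ?thesis using \<open>0 < k\<close> by (intro exI[of _ "k + i"]) auto
    qed
    have down: "\<exists>j<i. tt j y \<in> A" if hit: "tt i y \<in> A" for i
    proof -
      have "tt i y \<notin> W2" using elim by blast
      then obtain k where "k < 0" "tt k (tt i y) \<in> A" using hit by (auto simp: W2_def)
      then have "tt (k + i) y \<in> A" using tt_add[of y k i] elim by simp
      then show ?thesis using \<open>k < 0\<close> by (intro exI[of _ "k + i"]) auto
    qed
    have U: "\<exists>j\<ge>i0 + int n. tt j y \<in> A" for n
    proof (induction n)
      case 0 then show ?case using i0 by auto
    next
      case (Suc n)
      then obtain j where "j \<ge> i0 + int n" "tt j y \<in> A" by blast
      then obtain j' where "j' > j" "tt j' y \<in> A" using up by blast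
      then show ?case using \<open>j \<ge> i0 + int n\<close> by (intro exI[of _ j']) auto
    qed
    have D: "\<exists>j\<le>i0 - int n. tt j y \<in> A" for n
    proof (induction n)
      case 0 then show ?case using i0 by auto
    next
      case (Suc n)
      then obtain j where "j \<le> i0 - int n" "tt j y \<in> A" by blast
      then obtain j' where "j' < j" "tt j' y \<in> A" using down by blast
      then show ?case using \<open>j \<le> i0 - int n\<close> by (intro exI[of _ j']) auto
    qed
    show ?case
    proof (intro allI conjI)
      fix i
      show "\<exists>j>i. tt j y \<in> A"
      proof -
        obtain j where "j \<ge> i0 + int (nat (i + 1 - i0))" "tt j y \<in> A" using U by blast
        moreover from this(1) have "j > i" by linarith
        ultimately show ?thesis by blast
      qed
      show "\<exists>j<i. tt j y \<in> A"
      proof -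
        obtain j where "j \<le> i0 - int (nat (i0 + 1 - i))" "tt j y \<in> A" using D by blast
        moreover from this(1) have "j < i" by linarith
        ultimately show ?thesis by blast
      qed
    qed
  qed
qed

lemma AE_ex:
  assumes "AE y in M. P y"
  obtains y where "y \<in> space M" "P y"
proof -
  have "\<not> (AE y in M. False)"
    using inf_space AE_iff_measurable[of "space M" M "\<lambda>_. False"] by auto
  moreover have "AE y in M. False" if "\<not> (\<exists>y\<in>space M. P y)"
    using assms AE_space by eventually_elim (use that in blast)
  ultimately show thesis using that by blast
qed

text \<open>
  Take the points of \<open>G\<close> that did not visit \<open>G\<close> during the previous \<open>n - 1\<close> steps. Since the space is
  infinite and \<open>G\<close> is not, almost every orbit stays away from \<open>G\<close> for \<open>n\<close> steps and later returns.
\<close>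

lemma ex_marker:
  assumes [measurable]: "G \<in> sets M" and G: "emeasure M G > 0" "emeasure M G < \<infinity>"
  shows "\<exists>F\<in>sets M. F \<subseteq> G \<and> emeasure M F > 0 \<and> (\<forall>y\<in>F. \<forall>i. 0 < i \<and> i < int n \<longrightarrow> tt i y \<notin> F)"
proof -
  define F where "F = {y \<in> G. \<forall>i. 0 < i \<and> i < int n \<longrightarrow> tt (- i) y \<notin> G}"
  define D where "D = (\<Union>i\<in>{0..<int n}. tt (- i) -` G \<inter> space M)"
  have sp: "y \<in> G \<Longrightarrow> y \<in> space M" for y
    using sets.sets_into_space[OF assms(1)] by auto
  have [measurable]: "F \<in> sets M" "D \<in> sets M" unfolding F_def D_def by measurable
  have "emeasure M D \<le> (\<Sum>i\<in>{0..<int n}. emeasure M (tt (- i) -` G \<inter> space M))"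
    unfolding D_def by (intro emeasure_subadditive_finite) auto
  also have "\<dots> < \<infinity>"
    using G(2) by (simp add: tt_preserve ennreal_mult_less_top of_nat_less_top)
  finally have Dfin: "emeasure M D < \<infinity>" .
  have Dpos: "emeasure M (space M - D) > 0"
  proof (rule ccontr)
    assume "\<not> ?thesis"
    then have "emeasure M (space M - D) = 0" by simp
    moreover have "emeasure M (space M) \<le> emeasure M D + emeasure M (space M - D)"
      using emeasure_subadditive[of D M "space M - D"] sets.sets_into_space[of D M]
      by (simp add: Un_absorb1)
    ultimately show False using Dfin inf_space by auto
  qed
  have "emeasure M F > 0"
  proof (rule ccontr)
    assume "\<not> ?thesis"
    then have "AE y in M. y \<notin> F" by (intro AE_not_in) (auto simp: null_sets_def)
    then have "AE y in M. (\<forall>i. tt i y \<notin> F) \<and> (\<exists>i. tt i y \<in> space M - D) \<and> (\<forall>i. \<exists>j>i. tt j y \<in> G)"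
      using AE_tt[of "\<lambda>y. y \<notin> F"] AE_visit[of "space M - D"] Dpos AE_recurrent[OF assms(1) G(1)]
      by auto
    then obtain y where y: "y \<in> space M" "\<And>i. tt i y \<notin> F" "\<exists>i. tt i y \<in> space M - D"
      "\<And>i. \<exists>j>i. tt j y \<in> G"
      by (rule AE_ex) blast
    obtain t where t: "tt t y \<in> space M - D" using y(3) by blast
    define k where "k = (LEAST k::nat. 0 < k \<and> tt (t + int k) y \<in> G)"
    obtain j where "j > t" "tt j y \<in> G" using y(4) by blast
    then have "0 < nat (j - t) \<and> tt (t + int (nat (j - t))) y \<in> G" by simp
    then have k: "0 < k \<and> tt (t + int k) y \<in> G" unfolding k_def by (rule LeastI)
    have least: "tt (t + int l) y \<notin> G" if "0 < l" "l < k" for l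
      using that not_less_Least[of l "\<lambda>k. 0 < k \<and> tt (t + int k) y \<in> G"] unfolding k_def by blast
    have "tt (t + int k) y \<in> F"
      unfolding F_def
    proof (intro CollectI conjI allI impI)
      fix i assume i: "0 < i \<and> i < int n"
      have eq: "tt (- i) (tt (t + int k) y) = tt (t + int k - i) y"
        using tt_add[OF y(1), of "- i" "t + int k"] by (simp add: algebra_simps)
      show "tt (- i) (tt (t + int k) y) \<notin> G"
      \<comment> \<open>Times strictly between \<open>t\<close> and \<open>t + k\<close> are
        excluded by the minimality of \<open>k\<close>, times up to \<open>t\<close> by the choice
        of \<open>tt t y\<close> outside \<open>D\<close>.\<close>
      proof (cases "int k > i")
        case True
        then show ?thesis
          using least[of "nat (int k - i)"] i k by (simp add: eq algebra_simps nat_less_iff)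
      next
        case False
        then have "i - int k \<in> {0..<int n}" using i k by auto
        then have "tt (- (i - int k)) (tt t y) \<notin> G"
          using t unfolding D_def by blast
        then show ?thesis
          using tt_add[OF y(1), of "- (i - int k)" t] by (simp add: eq algebra_simps)
      qed
    qed (use k in auto)
    with y(2) show False by blast
  qed
  moreover have "tt i y \<notin> F" if "y \<in> F" "0 < i" "i < int n" for y i
  proof
    assume "tt i y \<in> F"
    then have "tt (- i) (tt i y) \<notin> G" using that by (auto simp: F_def)
    then show False
      using that tt_add[of y "- i" i] sp[of y] by (auto simp: F_def)
  qed
  ultimately show ?thesis
    by (intro bexI[of _ F]) (auto simp: F_def)
qed

end

section \<open>The ratio ergodic theorem\<close>

text \<open>The maximum of the first \<open>n\<close> partial sums of \<open>f\<close> along the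
  orbit and of the empty sum. The recursion is the identity behind the maximal ergodic
  theorem.\<close>

primrec running_max :: "('a \<Rightarrow> 'a) \<Rightarrow> ('a \<Rightarrow> real) \<Rightarrow> nat \<Rightarrow> 'a \<Rightarrow> real" where
  "running_max T f 0 y = 0"
| "running_max T f (Suc n) y = max 0 (f y + running_max T f n (T y))"

lemma running_max_mono: "running_max T f n y \<le> running_max T f (Suc n) y"
proof (induction n arbitrary: y)
  case (Suc n)
  from Suc[of "T y"] show ?case by simp
qed simp

lemma running_max_nonneg: "0 \<le> running_max T f n y"
  by (cases n) auto

context ergodic_infinite
begin

lemma sum_le_running_max:
  "y \<in> space M \<Longrightarrow> (\<Sum>i<n. f (tt (int i) y)) \<le> running_max T f n y"
proof (induction n arbitrary: y)
  case (Suc n)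
  have "(\<Sum>i<Suc n. f (tt (int i) y)) = f y + (\<Sum>i<n. f (tt (int i) (T y)))"
    using Suc.prems by (simp add: sum.lessThan_Suc_shift tt_Suc del: sum.lessThan_Suc)
  then show ?case
    using Suc.IH[of "T y"] measurable_space[OF meas] Suc.prems by auto
qed simp

lemma distr_T: "distr M M T = M"
  by (rule measure_eqI) (auto simp: emeasure_distr preserve)

lemma integrable_T:
  fixes f :: "'a \<Rightarrow> real"
  assumes "integrable M f"
  shows "integrable M (\<lambda>y. f (T y))" "(\<integral>y. f (T y) \<partial>M) = (\<integral>y. f y \<partial>M)"
proof -
  have [measurable]: "f \<in> borel_measurable M" using assms by auto
  show "integrable M (\<lambda>y. f (T y))"
    using integrable_distr_eq[of T M M f] assms by (simp add: distr_T)
  show "(\<integral>y. f (T y) \<partial>M) = (\<integral>y. f y \<partial>M)"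
    using integral_distr[of T M M f] by (simp add: distr_T)
qed

lemma integrable_running_max: "integrable M f \<Longrightarrow> integrable M (running_max T f n)"
proof (induction n)
  case (Suc n)
  then have "integrable M (\<lambda>y. max 0 (f y + running_max T f n (T y)))"
    by (intro integrable_max integrable_zero Bochner_Integration.integrable_add integrable_T) auto
  then show ?case by simp
qed (simp add: running_max.simps(1)[abs_def])

text \<open>
  If the running maximum were unbounded almost everywhere, its increments
  \<open>running_max T f (n + 1) - running_max T f n \<circ> T\<close>, whose integrals are nonnegative, would decrease
  to \<open>f\<close>.
\<close>

lemma AE_sums_bdd_above:
  fixes f :: "'a \<Rightarrow> real"
  assumes f: "integrable M f" and neg: "(\<integral>y. f y \<partial>M) < 0"
  shows "AE y in M. \<exists>c. \<forall>n. (\<Sum>i<n. f (tt (int i) y)) \<le> c"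
proof -
  define R where "R = running_max T f"
  note intR = integrable_running_max[OF f, folded R_def]
  have [measurable]: "f \<in> borel_measurable M" using f by auto
  have [measurable]: "R n \<in> borel_measurable M" for n using intR[of n] by auto
  have monoR: "m \<le> n \<Longrightarrow> R m y \<le> R n y" for m n y
    unfolding R_def using running_max_mono by (rule lift_Suc_mono_le)
  define E where "E = {y \<in> space M. \<forall>c::nat. \<exists>n. R n y > real c}"
  have [measurable]: "E \<in> sets M" unfolding E_def by measurable
  have E_iff: "y \<in> E \<longleftrightarrow> (\<forall>c. \<exists>n. R n y > c)" if "y \<in> space M" for y
  proof
    assume "y \<in> E"
    show "\<forall>c. \<exists>n. R n y > c"
    proof
      fix c
      obtain k :: nat where "c \<le> real k" using real_arch_simple by blast
      moreover obtain n where "R n y > real k" using \<open>y \<in> E\<close> by (auto simp: E_def)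
      ultimately show "\<exists>n. R n y > c" by (intro exI[of _ n]) auto
    qed
  qed (use that in \<open>auto simp: E_def\<close>)
  have step: "R (Suc n) y = max 0 (f y + R n (T y))" for n y by (simp add: R_def)
  have "T y \<in> E \<longleftrightarrow> y \<in> E" if y: "y \<in> space M" for y
  proof -
    \<comment> \<open>Replacing \<open>y\<close> by \<open>T y\<close> changes partial sums only by
      the finite number \<open>f y\<close>, which makes \<open>E\<close> invariant.\<close>
    have "(\<forall>c. \<exists>n. R n (T y) > c) \<longleftrightarrow> (\<forall>c. \<exists>n. R n y > c)"
    proof safe
      fix c assume "\<forall>c. \<exists>n. R n (T y) > c"
      then obtain n where "R n (T y) > c - f y" by blast
      then show "\<exists>n. R n y > c" by (intro exI[of _ "Suc n"]) (auto simp: step)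
    next
      fix c assume "\<forall>c. \<exists>n. R n y > c"
      then obtain n where n: "R n y > max 0 (c + f y)" by blast
      then obtain n' where "n = Suc n'" by (cases n) (auto simp: R_def)
      with n show "\<exists>n. R n (T y) > c" by (intro exI[of _ n']) (auto simp: step)
    qed
    then show ?thesis using y measurable_space[OF meas y] by (simp add: E_iff)
  qed
  then have "(AE y in M. y \<notin> E) \<or> (AE y in M. y \<in> E)"
    by (intro AE_invariant_cases) auto
  moreover have "\<not> (AE y in M. y \<in> E)"
  proof
    assume AE: "AE y in M. y \<in> E"
    define h where "h = (\<lambda>n y. R (Suc n) y - R n (T y))"
    \<comment> \<open>This form shows both that \<open>h n\<close> is dominated by the absolute
      value of \<open>f\<close>, because the running maximum is nonnegative, and that
      \<open>h n y\<close> equals \<open>f y\<close> once the running maximum at \<open>T y\<close>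
      is large.\<close>
    have h: "h n y = max (- R n (T y)) (f y)" for n y by (auto simp: h_def step)
    have "(\<lambda>n. \<integral>y. h n y \<partial>M) \<longlonglongrightarrow> (\<integral>y. f y \<partial>M)"
    proof (rule integral_dominated_convergence)
      show "integrable M (\<lambda>y. \<bar>f y\<bar>)" using f by simp
      show "h n \<in> borel_measurable M" for n unfolding h_def by measurable
      have "- R n (T y) \<le> 0" for n y using running_max_nonneg[of T f n "T y"] by (simp add: R_def)
      then show "AE y in M. norm (h n y) \<le> \<bar>f y\<bar>" for n
        by (intro AE_I2) (smt (verit) h real_norm_def)
      show "AE y in M. (\<lambda>n. h n y) \<longlonglongrightarrow> f y"
        using AE AE_space
      proof eventually_elim
        case (elim y)
        then have "y \<in> E" "y \<in> space M" by auto
        then have "\<forall>c. \<exists>n. R n y > c" by (simp add: E_iff)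
        then obtain n where n: "R n y > max 0 (f y + \<bar>f y\<bar>)" by blast
        then obtain n' where n': "n = Suc n'" by (cases n) (auto simp: R_def)
        have "h m y = f y" if "m \<ge> n'" for m
          using monoR[OF that, of "T y"] n unfolding n' h by (auto simp: step max_def split: if_splits)
        then show ?case
          by (intro tendsto_eventually) (auto simp: eventually_sequentially)
      qed
    qed simp
    moreover have "(\<integral>y. h n y \<partial>M) \<ge> 0" for n
    proof -
      have "(\<integral>y. h n y \<partial>M) = (\<integral>y. R (Suc n) y \<partial>M) - (\<integral>y. R n y \<partial>M)"
        unfolding h_def using intR integrable_T[OF intR]
        by (subst Bochner_Integration.integral_diff) auto
      also have "\<dots> \<ge> 0"
        using intR monoR by (simp add: integral_mono)
      finally show ?thesis .
    qed
    ultimately show False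
      using neg by (metis LIMSEQ_le_const not_le)
  qed
  ultimately have "AE y in M. y \<notin> E" by blast
  then show ?thesis
    using AE_space
  proof eventually_elim
    case (elim y)
    then obtain c where "\<And>n. R n y \<le> c" by (force simp: E_iff not_less)
    then show ?case
      using sum_le_running_max[OF elim(2), of f] unfolding R_def by (meson order_trans)
  qed
qed

lemma AE_visits_unbounded:
  assumes [measurable]: "K \<in> sets M" and pos: "emeasure M K > 0"
  shows "AE y in M. \<forall>c. \<exists>n0. \<forall>n\<ge>n0. c \<le> (\<Sum>i<n. indicat_real K (tt (int i) y))"
  using AE_recurrent[OF assms]
proof eventually_elim
  case (elim y)
  let ?S = "\<lambda>n. \<Sum>i<n. indicat_real K (tt (int i) y)"
  have mono: "m \<le> n \<Longrightarrow> ?S m \<le> ?S n" for m n by (intro sum_mono2) auto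
  have *: "\<exists>n. real k \<le> ?S n" for k
  proof (induction k)
    case 0 then show ?case by (auto intro: exI[of _ 0])
  next
    case (Suc k)
    then obtain n where n: "real k \<le> ?S n" by blast
    obtain j where j: "j > int n" "tt j y \<in> K" using elim by blast
    have "?S (Suc (nat j)) = ?S (nat j) + 1" using j by simp
    moreover have "?S n \<le> ?S (nat j)" using j by (intro mono) auto
    ultimately show ?case using n by (intro exI[of _ "Suc (nat j)"]) auto
  qed
  show ?case
  proof
    fix c
    obtain k :: nat where "c \<le> real k" using real_arch_simple by blast
    moreover obtain n0 where "real k \<le> ?S n0" using * by blast
    ultimately show "\<exists>n0. \<forall>n\<ge>n0. c \<le> ?S n"
      using mono by (meson order_trans)
  qed
qed

text \<open>Hopf's ratio theorem for indicators. Moving the ratio \<open>p\<close> by half of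
  \<delta> to either side gives two functions of negative integral, whose partial sums are bounded
  above. As the visits to \<open>K\<close> tend to infinity, the other half of \<delta> absorbs
  these bounds.\<close>

lemma AE_ratio:
  fixes \<delta> :: real
  assumes K: "K \<in> sets M" "0 < emeasure M K" "emeasure M K < \<infinity>"
    and C: "C \<in> sets M" "emeasure M C < \<infinity>" and \<delta>: "\<delta> > 0"
  shows "AE y in M. \<exists>n0. \<forall>n\<ge>n0.
    \<bar>(\<Sum>i<n. indicat_real C (tt (int i) y)) - measure M C / measure M K * (\<Sum>i<n. indicat_real K (tt (int i) y))\<bar>
      \<le> \<delta> * (\<Sum>i<n. indicat_real K (tt (int i) y))"
proof -
  define p where "p = measure M C / measure M K"
  have Kpos: "measure M K > 0"
    using K by (simp add: measure_def enn2real_positive_iff)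
  have int: "integrable M (indicat_real C)" "integrable M (indicat_real K)"
    using C K by auto
  let ?f = "\<lambda>y. indicat_real C y - (p + \<delta> / 2) * indicat_real K y"
  let ?g = "\<lambda>y. (p - \<delta> / 2) * indicat_real K y - indicat_real C y"
  have "(\<integral>y. ?f y \<partial>M) = measure M C - (p + \<delta> / 2) * measure M K"
    using int C(1) K(1) by (subst Bochner_Integration.integral_diff) auto
  also have "\<dots> < 0" using \<delta> Kpos by (simp add: p_def algebra_simps)
  finally have f: "AE y in M. \<exists>c. \<forall>n. (\<Sum>i<n. ?f (tt (int i) y)) \<le> c"
    using int by (intro AE_sums_bdd_above) auto
  have "(\<integral>y. ?g y \<partial>M) = (p - \<delta> / 2) * measure M K - measure M C"
    using int C(1) K(1) by (subst Bochner_Integration.integral_diff) auto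
  also have "\<dots> < 0" using \<delta> Kpos by (simp add: p_def algebra_simps)
  finally have g: "AE y in M. \<exists>c. \<forall>n. (\<Sum>i<n. ?g (tt (int i) y)) \<le> c"
    using int by (intro AE_sums_bdd_above) auto
  show ?thesis
    unfolding p_def[symmetric]
    using f g AE_visits_unbounded[OF K(1,2)]
  proof eventually_elim
    case (elim y)
    let ?c = "\<lambda>n. \<Sum>i<n. indicat_real C (tt (int i) y)"
    let ?k = "\<lambda>n. \<Sum>i<n. indicat_real K (tt (int i) y)"
    obtain a b where ab: "\<And>n. ?c n - (p + \<delta> / 2) * ?k n \<le> a" "\<And>n. (p - \<delta> / 2) * ?k n - ?c n \<le> b"
      using elim by (auto simp: sum_subtractf sum_distrib_left)
    obtain n0 where n0: "\<And>n. n \<ge> n0 \<Longrightarrow> 2 * max a b / \<delta> \<le> ?k n"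
      using elim(3) by blast
    have "\<bar>?c n - p * ?k n\<bar> \<le> \<delta> * ?k n" if "n \<ge> n0" for n
    proof -
      have "max a b \<le> \<delta> / 2 * ?k n"
        using n0[OF that] \<delta> by (simp add: field_simps)
      then show ?thesis
        using ab[of n] max.cobounded1[of a b] max.cobounded2[of b a]
        unfolding abs_le_iff distrib_right left_diff_distrib by linarith
    qed
    then show ?case by blast
  qed
qed

end

section \<open>Columns between cuts\<close>

text \<open>Read \<kappa> as the indicator of the limit set along an orbit, \<open>D\<close> as the
  deviation of a word count from its target and \<Phi> as the set of cut times. If \<kappa> does not
  vanish on a segment without inner cuts, then the short column around such a time contains the
  whole segment, which therefore has at most \<open>L\<close> terms.\<close>

lemma sum_between_cuts:
  fixes D \<kappa> :: "int \<Rightarrow> real" and \<Phi> :: "int set" and L :: nat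
  assumes dom: "\<And>t. \<bar>D t\<bar> \<le> \<kappa> t" and le1: "\<And>t. \<kappa> t \<le> 1"
    and short: "\<And>t. \<kappa> t \<noteq> 0 \<Longrightarrow> \<exists>p q. p \<le> t \<and> t < q \<and> q - p \<le> int L \<and> p \<in> \<Phi> \<and> q \<in> \<Phi>"
    and uncut: "{u<..<v} \<inter> \<Phi> = {}"
  shows "\<bar>\<Sum>t\<in>{u..<v}. D t\<bar> \<le> real L"
proof (cases "\<forall>t\<in>{u..<v}. \<kappa> t = 0")
  case True
  then have "D t = 0" if "t \<in> {u..<v}" for t using dom[of t] that by simp
  then show ?thesis by simp
next
  case False
  then obtain t where t: "u \<le> t" "t < v" "\<kappa> t \<noteq> 0" by auto
  obtain p q where pq: "p \<le> t" "t < q" "q - p \<le> int L" "p \<in> \<Phi>" "q \<in> \<Phi>"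
    using short[OF t(3)] by blast
  have "p \<notin> {u<..<v}" "q \<notin> {u<..<v}" using uncut pq by auto
  then have "v - u \<le> int L" using pq t by auto
  have "\<bar>\<Sum>t\<in>{u..<v}. D t\<bar> \<le> (\<Sum>t\<in>{u..<v}. \<bar>D t\<bar>)" by (rule sum_abs)
  also have "\<dots> \<le> (\<Sum>t\<in>{u..<v}. 1)" by (intro sum_mono) (meson dom le1 order_trans)
  also have "\<dots> \<le> real L" using \<open>v - u \<le> int L\<close> by simp
  finally show ?thesis .
qed

text \<open>Complete columns are split off from the left one at a time; only the last, possibly
  incomplete one is paid for with \<open>L\<close>.\<close>

lemma sum_from_cut:
  fixes D \<kappa> :: "int \<Rightarrow> real" and \<Phi> :: "int set" and L :: nat and \<delta> :: real
  assumes dom: "\<And>t. \<bar>D t\<bar> \<le> \<kappa> t" and le1: "\<And>t. \<kappa> t \<le> 1"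
    and short: "\<And>t. \<kappa> t \<noteq> 0 \<Longrightarrow> \<exists>p q. p \<le> t \<and> t < q \<and> q - p \<le> int L \<and> p \<in> \<Phi> \<and> q \<in> \<Phi>"
    and good: "\<And>p q. p \<in> \<Phi> \<Longrightarrow> q \<in> \<Phi> \<Longrightarrow> p < q \<Longrightarrow> {p<..<q} \<inter> \<Phi> = {} \<Longrightarrow>
      \<bar>\<Sum>t\<in>{p..<q}. D t\<bar> \<le> \<delta> * (\<Sum>t\<in>{p..<q}. \<kappa> t)"
    and \<delta>: "0 \<le> \<delta>" and u: "u \<in> \<Phi>"
  shows "\<bar>\<Sum>t\<in>{u..<v}. D t\<bar> \<le> \<delta> * (\<Sum>t\<in>{u..<v}. \<kappa> t) + real L"
  using u
proof (induction "nat (v - u)" arbitrary: u rule: less_induct)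
  case less
  have \<kappa>0: "0 \<le> (\<Sum>t\<in>A. \<kappa> t)" for A by (intro sum_nonneg) (meson dom abs_ge_zero order_trans)
  show ?case
  proof (cases "{u<..<v} \<inter> \<Phi> = {}")
    case True
    have "\<bar>\<Sum>t\<in>{u..<v}. D t\<bar> \<le> real L"
      by (rule sum_between_cuts[OF dom le1 short True])
    then show ?thesis
      using mult_nonneg_nonneg[OF \<delta> \<kappa>0, of "{u..<v}"] by linarith
  next
    case False
    define q where "q = Min ({u<..<v} \<inter> \<Phi>)"
    have q: "q \<in> {u<..<v} \<inter> \<Phi>" unfolding q_def using False by (intro Min_in) auto
    have "{u<..<q} \<inter> \<Phi> = {}"
    proof -
      have "r \<notin> \<Phi>" if "r \<in> {u<..<q}" for r
        using Min_le[of "{u<..<v} \<inter> \<Phi>" r] that q unfolding q_def by fastforce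
      then show ?thesis by blast
    qed
    then have 1: "\<bar>\<Sum>t\<in>{u..<q}. D t\<bar> \<le> \<delta> * (\<Sum>t\<in>{u..<q}. \<kappa> t)"
      using q less.prems by (intro good) auto
    have 2: "\<bar>\<Sum>t\<in>{q..<v}. D t\<bar> \<le> \<delta> * (\<Sum>t\<in>{q..<v}. \<kappa> t) + real L"
      using q by (intro less.hyps) auto
    have split: "(\<Sum>t\<in>{u..<v}. f t) = (\<Sum>t\<in>{u..<q}. f t) + (\<Sum>t\<in>{q..<v}. f t)" for f :: "int \<Rightarrow> real"
      using q by (subst sum.union_disjoint[symmetric]) (auto simp: ivl_disj_un)
    show ?thesis
      using 1 2 unfolding split distrib_left by linarith
  qed
qed

text \<open>An arbitrary segment has an incomplete column at each end, which explains the factor 2.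
  This error does not grow with the segment, so it is negligible once there are many visits.\<close>

lemma sum_over_columns:
  fixes D \<kappa> :: "int \<Rightarrow> real" and \<Phi> :: "int set" and L :: nat and \<delta> :: real
  assumes dom: "\<And>t. \<bar>D t\<bar> \<le> \<kappa> t" and le1: "\<And>t. \<kappa> t \<le> 1"
    and short: "\<And>t. \<kappa> t \<noteq> 0 \<Longrightarrow> \<exists>p q. p \<le> t \<and> t < q \<and> q - p \<le> int L \<and> p \<in> \<Phi> \<and> q \<in> \<Phi>"
    and good: "\<And>p q. p \<in> \<Phi> \<Longrightarrow> q \<in> \<Phi> \<Longrightarrow> p < q \<Longrightarrow> {p<..<q} \<inter> \<Phi> = {} \<Longrightarrow>
      \<bar>\<Sum>t\<in>{p..<q}. D t\<bar> \<le> \<delta> * (\<Sum>t\<in>{p..<q}. \<kappa> t)"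
    and \<delta>: "0 \<le> \<delta>"
  shows "\<bar>\<Sum>t\<in>{u..<v}. D t\<bar> \<le> \<delta> * (\<Sum>t\<in>{u..<v}. \<kappa> t) + 2 * real L"
proof (cases "{u<..<v} \<inter> \<Phi> = {}")
  case True
  have "0 \<le> (\<Sum>t\<in>{u..<v}. \<kappa> t)" by (intro sum_nonneg) (meson dom abs_ge_zero order_trans)
  then have "0 \<le> \<delta> * (\<Sum>t\<in>{u..<v}. \<kappa> t)" using \<delta> by simp
  moreover have "\<bar>\<Sum>t\<in>{u..<v}. D t\<bar> \<le> real L"
    by (rule sum_between_cuts[OF dom le1 short True])
  ultimately show ?thesis by linarith
next
  case False
  define q where "q = Min ({u<..<v} \<inter> \<Phi>)"
  have q: "q \<in> {u<..<v} \<inter> \<Phi>" unfolding q_def using False by (intro Min_in) auto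
  have uncut: "{u<..<q} \<inter> \<Phi> = {}"
  proof -
    have "r \<notin> \<Phi>" if "r \<in> {u<..<q}" for r
      using Min_le[of "{u<..<v} \<inter> \<Phi>" r] that q unfolding q_def by fastforce
    then show ?thesis by blast
  qed
  have 1: "\<bar>\<Sum>t\<in>{u..<q}. D t\<bar> \<le> real L"
    by (rule sum_between_cuts[OF dom le1 short uncut])
  have 2: "\<bar>\<Sum>t\<in>{q..<v}. D t\<bar> \<le> \<delta> * (\<Sum>t\<in>{q..<v}. \<kappa> t) + real L"
    using q by (intro sum_from_cut[OF dom le1 short good \<delta>]) auto
  have split: "(\<Sum>t\<in>{u..<v}. f t) = (\<Sum>t\<in>{u..<q}. f t) + (\<Sum>t\<in>{q..<v}. f t)" for f :: "int \<Rightarrow> real"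
    using q by (subst sum.union_disjoint[symmetric]) (auto simp: ivl_disj_un)
  have "0 \<le> (\<Sum>t\<in>{u..<q}. \<kappa> t)" by (intro sum_nonneg) (meson dom abs_ge_zero order_trans)
  then have "0 \<le> \<delta> * (\<Sum>t\<in>{u..<q}. \<kappa> t)" using \<delta> by simp
  then show ?thesis
    using 1 2 unfolding split distrib_left by linarith
qed

context ergodic_infinite
begin

text \<open>
  The \<open>F\<close>-columns are the orbit segments between consecutive visits to the cut set \<open>F\<close>.
\<close>

definition short_column :: "'a set \<Rightarrow> nat \<Rightarrow> 'a \<Rightarrow> bool" where
  "short_column F L y \<longleftrightarrow> (\<exists>i j. i \<le> 0 \<and> 0 < j \<and> j - i \<le> int L \<and> tt i y \<in> F \<and> tt j y \<in> F)"

lemma short_column_measurable [measurable]: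
  assumes [measurable]: "F \<in> sets M"
  shows "Measurable.pred M (short_column F L)"
  unfolding short_column_def by measurable

text \<open>One stage of the construction. The inclusion of the new cut set in \<open>F\<close> is
  what makes each earlier column lie inside a single later one.\<close>

lemma ex_good_cuts:
  fixes \<delta> \<eta> m :: real
  assumes K: "K \<in> sets M" "0 < emeasure M K" "emeasure M K < \<infinity>"
    and F: "F \<in> sets M" "0 < emeasure M F" "emeasure M F < \<infinity>"
    and \<C>: "finite \<C>" "\<And>C. C \<in> \<C> \<Longrightarrow> C \<in> sets M \<and> emeasure M C < \<infinity>"
    and \<delta>: "\<delta> > 0" and \<eta>: "\<eta> > 0"
  shows "\<exists>F'\<in>sets M. \<exists>L. F' \<subseteq> F \<and> 0 < emeasure M F' \<and> measure M {y \<in> K. \<not> short_column F' L y} < \<eta> \<and>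
    (\<forall>y\<in>F'. \<forall>n>0. tt (int n) y \<in> F' \<longrightarrow>
      m \<le> (\<Sum>i<n. indicat_real K (tt (int i) y)) \<and>
      (\<forall>C\<in>\<C>. \<bar>(\<Sum>i<n. indicat_real C (tt (int i) y)) -
          measure M C / measure M K * (\<Sum>i<n. indicat_real K (tt (int i) y))\<bar>
        \<le> \<delta> * (\<Sum>i<n. indicat_real K (tt (int i) y))))"
proof -
  note [measurable] = K(1) F(1)
  define good where "good y n \<longleftrightarrow>
      m \<le> (\<Sum>i<n. indicat_real K (tt (int i) y)) \<and>
      (\<forall>C\<in>\<C>. \<bar>(\<Sum>i<n. indicat_real C (tt (int i) y)) -
          measure M C / measure M K * (\<Sum>i<n. indicat_real K (tt (int i) y))\<bar>
        \<le> \<delta> * (\<Sum>i<n. indicat_real K (tt (int i) y)))" for y n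
  define G where "G n = {y \<in> F. \<forall>n'\<ge>n. good y n'}" for n
  have [measurable]: "Measurable.pred M (\<lambda>y. good y n)" for n
  proof -
    have [measurable]: "Measurable.pred M (\<lambda>y. \<bar>(\<Sum>i<n. indicat_real C (tt (int i) y)) -
          measure M C / measure M K * (\<Sum>i<n. indicat_real K (tt (int i) y))\<bar>
        \<le> \<delta> * (\<Sum>i<n. indicat_real K (tt (int i) y)))" if "C \<in> \<C>" for C
    proof -
      have [measurable]: "C \<in> sets M" using that \<C>(2) by blast
      show ?thesis by measurable
    qed
    have "Measurable.pred M (\<lambda>y. \<forall>C\<in>\<C>. \<bar>(\<Sum>i<n. indicat_real C (tt (int i) y)) -
          measure M C / measure M K * (\<Sum>i<n. indicat_real K (tt (int i) y))\<bar>
        \<le> \<delta> * (\<Sum>i<n. indicat_real K (tt (int i) y)))"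
      using \<C>(1) by (rule pred_intros_finite) measurable
    then show ?thesis unfolding good_def by measurable
  qed
  have [measurable]: "G n \<in> sets M" for n unfolding G_def by measurable
  have "AE y in M. \<exists>n. \<forall>n'\<ge>n. good y n'"
  proof -
    have "AE y in M. \<forall>C\<in>\<C>. \<exists>n0. \<forall>n\<ge>n0.
       \<bar>(\<Sum>i<n. indicat_real C (tt (int i) y)) - measure M C / measure M K * (\<Sum>i<n. indicat_real K (tt (int i) y))\<bar>
         \<le> \<delta> * (\<Sum>i<n. indicat_real K (tt (int i) y))"
      using \<C> by (intro AE_finite_allI AE_ratio[OF K]) (auto simp: \<delta>)
    then show ?thesis
      using AE_visits_unbounded[OF K(1,2)]
    proof eventually_elim
      case (elim y)
      have "\<forall>\<^sub>F n in sequentially. m \<le> (\<Sum>i<n. indicat_real K (tt (int i) y))"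
        using elim(2) by (simp add: eventually_sequentially)
      moreover have "\<forall>\<^sub>F n in sequentially. \<forall>C\<in>\<C>. \<bar>(\<Sum>i<n. indicat_real C (tt (int i) y)) -
          measure M C / measure M K * (\<Sum>i<n. indicat_real K (tt (int i) y))\<bar>
        \<le> \<delta> * (\<Sum>i<n. indicat_real K (tt (int i) y))"
        using elim(1) by (intro eventually_ball_finite \<C>(1)) (unfold eventually_sequentially)
      ultimately have "\<forall>\<^sub>F n in sequentially. good y n"
        unfolding good_def by eventually_elim blast
      then show ?case by (simp add: eventually_sequentially)
    qed
  qed
  have "\<exists>n. emeasure M (G n) > 0"
  proof (rule ccontr)
    assume "\<not> ?thesis"
    then have "AE y in M. y \<notin> G n" for n by (intro AE_not_in) (auto simp: null_sets_def)
    then have "AE y in M. \<forall>n. y \<notin> G n" by (simp add: AE_all_countable)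
    with \<open>AE y in M. \<exists>n. \<forall>n'\<ge>n. good y n'\<close> have "AE y in M. y \<notin> F"
      by eventually_elim (auto simp: G_def)
    then have "emeasure M F = 0" using AE_iff_null_sets[OF F(1)] by auto
    with F(2) show False by simp
  qed
  then obtain n where n: "emeasure M (G n) > 0" by blast
  have "emeasure M (G n) \<le> emeasure M F" by (rule emeasure_mono) (auto simp: G_def)
  then have "emeasure M (G n) < \<infinity>" using F(3) by auto
  then obtain F' where F': "F' \<in> sets M" "F' \<subseteq> G n" "emeasure M F' > 0"
    "\<And>y i. y \<in> F' \<Longrightarrow> 0 < i \<Longrightarrow> i < int n \<Longrightarrow> tt i y \<notin> F'"
    using ex_marker[of "G n" n] n by auto
  note [measurable] = F'(1)
  \<comment> \<open>Almost every point has cuts both before and after it, so these sets decrease to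
    a null set.\<close>
  define B where "B L = {y \<in> K. \<not> short_column F' L y}" for L
  have [measurable]: "B L \<in> sets M" for L unfolding B_def by measurable
  have "(\<lambda>L. measure M (B L)) \<longlonglongrightarrow> measure M (\<Inter>L. B L)"
  proof (rule Lim_measure_decseq)
    show "decseq B" unfolding decseq_def B_def short_column_def by (auto; meson of_nat_mono order_trans)
    have "emeasure M (B L) \<le> emeasure M K" for L by (rule emeasure_mono) (auto simp: B_def)
    then show "emeasure M (B L) \<noteq> \<infinity>" for L using K(3) by (metis infinity_ennreal_def leD top.not_eq_extremum)
  qed auto
  moreover have "AE y in M. y \<notin> (\<Inter>L. B L)"
    using AE_recurrent[OF F'(1,3)]
  proof eventually_elim
    case (elim y)
    obtain i where i: "i < 0" "tt i y \<in> F'" using elim by blast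
    obtain j where j: "j > 0" "tt j y \<in> F'" using elim by blast
    have "short_column F' (nat (j - i)) y"
      unfolding short_column_def using i j by (intro exI[of _ i] exI[of _ j]) auto
    then show ?case by (auto simp: B_def)
  qed
  then have "measure M (\<Inter>L. B L) = 0"
    using AE_iff_null_sets[of "\<Inter>L. B L" M] by (auto simp: null_sets_def measure_def)
  ultimately have "\<forall>\<^sub>F L in sequentially. measure M (B L) < \<eta>"
    using \<eta> by (auto intro: order_tendstoD)
  then obtain L where L: "measure M (B L) < \<eta>" by (auto simp: eventually_sequentially)
  have "good y n'" if "y \<in> F'" "0 < n'" "tt (int n') y \<in> F'" for y n'
  proof -
    \<comment> \<open>The gaps of the marker set are at least \<open>n\<close>, the length from
      which all segments starting in \<open>G n\<close> are good.\<close>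
    have "n' \<ge> n" using F'(4)[of y "int n'"] that by force
    then show ?thesis using F'(2) that by (auto simp: G_def)
  qed
  then show ?thesis
    using F' L unfolding good_def B_def by (intro bexI[of _ F'] exI[of _ L]) (auto simp: G_def)
qed

text \<open>Words are read after erasing: a point outside \<open>K\<close> carries the letter 1 of
  the infinite atom. With the labelling \<open>l\<close> fixed, the partitions of all stages and of
  the limit differ only in the argument \<open>K\<close>.\<close>

definition cyl :: "('a \<Rightarrow> nat) \<Rightarrow> 'a set \<Rightarrow> int set \<Rightarrow> (int \<Rightarrow> nat) \<Rightarrow> 'a set" where
  "cyl l K I a = {y \<in> space M. \<forall>i\<in>I. (if tt i y \<in> K then l (tt i y) else 1) = a i}"

lemma cyl_measurable [measurable]:
  assumes [measurable]: "l \<in> M \<rightarrow>\<^sub>M count_space UNIV" "K \<in> sets M"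
  shows "cyl l K I a \<in> sets M"
  unfolding cyl_def by (intro sets.sets_Collect_countable_Ball) (auto intro!: countableI_type; measurable)

lemma cyl_subset: "0 \<in> I \<Longrightarrow> a 0 \<noteq> 1 \<Longrightarrow> cyl l K I a \<subseteq> K"
  unfolding cyl_def by (force split: if_splits)

text \<open>There are infinitely many functions \<open>a\<close>, but a letter above
  \<open>N\<close> makes the cylinder empty, and the values of \<open>a\<close> outside the window
  do not affect it.\<close>

lemma finite_cyls:
  assumes "finite W" and l: "\<And>y. y \<in> space M \<Longrightarrow> l y \<in> {1..N}"
  shows "finite {cyl l K I a | I a. I \<subseteq> W}"
proof -
  have "{cyl l K I a | I a. I \<subseteq> W} \<subseteq> insert {} ((\<lambda>(I, a). cyl l K I a) ` (Pow W \<times> PiE W (\<lambda>_. {..N})))"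
  proof clarify
    fix I a assume I: "I \<subseteq> W" and "cyl l K I a \<notin> (\<lambda>(I, a). cyl l K I a) ` (Pow W \<times> PiE W (\<lambda>_. {..N}))"
    moreover define a' where "a' = (\<lambda>i\<in>W. if i \<in> I then a i else 0)"
    have "cyl l K I a = cyl l K I a'"
      using I by (auto simp: cyl_def a'_def)
    ultimately have "a' \<notin> PiE W (\<lambda>_. {..N})" by force
    then obtain i where i: "i \<in> I" "i \<in> W" "a i > N" by (force simp: a'_def)
    show "cyl l K I a = {}"
    proof (rule ccontr)
      assume "cyl l K I a \<noteq> {}"
      then obtain y where "y \<in> space M" "(if tt i y \<in> K then l (tt i y) else 1) = a i"
        using i by (auto simp: cyl_def)
      then show False using l[of "tt i y"] i(3) by (auto split: if_splits)
    qed
  qed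
  moreover have "finite (insert {} ((\<lambda>(I, a). cyl l K I a) ` (Pow W \<times> PiE W (\<lambda>_. {..N}))))"
    using assms(1) by (auto intro!: finite_PiE)
  ultimately show ?thesis by (rule finite_subset)
qed

end

section \<open>Erasing along nested cut sets\<close>

context ergodic_infinite
begin

text \<open>Windows need not be symmetric: in the final proof a letter other than 1 of an arbitrary
  word is moved to time 0, and the window moves with it.\<close>

definition block_tests :: "('a \<Rightarrow> nat) \<Rightarrow> 'a set \<Rightarrow> nat \<Rightarrow> 'a set set" where
  "block_tests l K k = {cyl l K I a | I a. I \<subseteq> {- int k..int k} \<and> 0 \<in> I \<and> a 0 \<noteq> 1}"

text \<open>
  Changing the labels outside a column affects at most \<open>2 * k\<close> windows inside it. The constant
  \<open>2 * (k + 1)\<^sup>2\<close> makes this a proportion of at most \<open>1 / (k + 1)\<close> of the visits to \<open>K\<close>.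
\<close>

definition good_cuts :: "('a \<Rightarrow> nat) \<Rightarrow> 'a set \<Rightarrow> nat \<Rightarrow> 'a set \<Rightarrow> bool" where
  "good_cuts l K k F \<longleftrightarrow> (\<forall>y\<in>F. \<forall>n>0. tt (int n) y \<in> F \<longrightarrow>
      2 * (real k + 1)^2 \<le> (\<Sum>i<n. indicat_real K (tt (int i) y)) \<and>
      (\<forall>C\<in>block_tests l K k. \<bar>(\<Sum>i<n. indicat_real C (tt (int i) y)) -
          measure M C / measure M K * (\<Sum>i<n. indicat_real K (tt (int i) y))\<bar>
        \<le> 1 / (real k + 1) * (\<Sum>i<n. indicat_real K (tt (int i) y))))"

text \<open>The losses are halved from stage to stage, so together they stay within \<eta>. In
  particular every \<open>K k\<close> keeps positive measure, without which the ratio theorem could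
  not be applied to it at the next stage.\<close>

lemma ex_cut_sequence:
  fixes \<eta> :: real
  assumes l [measurable]: "l \<in> M \<rightarrow>\<^sub>M count_space UNIV" and lN: "\<And>y. y \<in> space M \<Longrightarrow> l y \<in> {1..N}"
    and K0: "K0 \<in> sets M" "emeasure M K0 < \<infinity>"
    and \<eta>: "0 < \<eta>" "\<eta> < measure M K0"
  obtains K F L where "\<And>k. K k \<in> sets M" "\<And>k. K k \<subseteq> K0" "\<And>k. measure M (K0 - K k) \<le> \<eta>"
    "\<And>k. F (Suc k) \<subseteq> F k" "\<And>k. K (Suc k) = {y \<in> K k. short_column (F (Suc k)) (L (Suc k)) y}"
    "\<And>k. good_cuts l (K k) k (F (Suc k))"
proof -
  note [measurable] = K0(1)
  have K0fin: "emeasure M A \<noteq> \<infinity>" "emeasure M A < \<infinity>" if "A \<subseteq> K0" for A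
    using emeasure_mono[OF that K0(1)] K0(2) by auto
  have K0pos: "0 < emeasure M K0"
    using \<eta> by (auto simp: measure_def zero_less_iff_neq_zero)
  define P where "P = (\<lambda>k (K, F, L::nat). K \<in> sets M \<and> K \<subseteq> K0 \<and> F \<in> sets M \<and> F \<subseteq> K0 \<and>
    0 < emeasure M F \<and> measure M (K0 - K) \<le> \<eta> * (1 - (1/2)^k))"
  define Q where "Q = (\<lambda>k (K, F, L::nat) (K', F', L'). F' \<subseteq> F \<and> K' = {y \<in> K. short_column F' L' y} \<and>
    good_cuts l K k F')"
  have "\<exists>f. \<forall>k. P k (f k) \<and> Q k (f k) (f (Suc k))"
  proof (rule dependent_nat_choice)
    show "\<exists>s. P 0 s"
      using K0 K0pos by (intro exI[of _ "(K0, K0, 0)"]) (auto simp: P_def)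
  next
    fix s k assume "P k s"
    then obtain K F L where s: "s = (K, F, L)" and [measurable]: "K \<in> sets M" "F \<in> sets M"
      and KF: "K \<subseteq> K0" "F \<subseteq> K0" "0 < emeasure M F" and ms: "measure M (K0 - K) \<le> \<eta> * (1 - (1/2)^k)"
      by (auto simp: P_def split: prod.splits)
    have "measure M (K0 - K) \<le> \<eta> * 1"
      using ms \<eta>(1) by (intro order_trans[OF ms] mult_left_mono) auto
    moreover have "measure M (K0 - K) = measure M K0 - measure M K"
      using K0fin by (intro measure_Diff) (use KF in auto)
    ultimately have "0 < measure M K" using \<eta> by simp
    then have Kpos: "0 < emeasure M K" by (auto simp: measure_def zero_less_iff_neq_zero)
    have fin: "finite (block_tests l K k)"
      by (rule finite_subset[OF _ finite_cyls[of "{- int k..int k}" l N K, OF _ lN]]) (auto simp: block_tests_def)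
    have C: "C \<in> sets M \<and> emeasure M C < \<infinity>" if "C \<in> block_tests l K k" for C
    proof -
      obtain I a where Ia: "C = cyl l K I a" "0 \<in> I" "a 0 \<noteq> 1"
        using \<open>C \<in> block_tests l K k\<close> by (auto simp: block_tests_def)
      then have "C \<subseteq> K0" using cyl_subset[of I a l K] KF by auto
      then show ?thesis using K0fin Ia by auto
    qed
    obtain F' L' where F': "F' \<in> sets M" "F' \<subseteq> F" "0 < emeasure M F'" "good_cuts l K k F'"
      and small: "measure M {y \<in> K. \<not> short_column F' L' y} < \<eta> * (1/2)^(k+1)"
      using ex_good_cuts[of K F "block_tests l K k" "1 / (real k + 1)" "\<eta> * (1/2)^(k+1)" "2 * (real k + 1)^2"]
        fin C KF Kpos K0fin \<eta>(1) unfolding good_cuts_def by auto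
    note [measurable] = F'(1)
    define K' where "K' = {y \<in> K. short_column F' L' y}"
    have [measurable]: "K' \<in> sets M" unfolding K'_def by measurable
    have "K0 - K' = (K0 - K) \<union> {y \<in> K. \<not> short_column F' L' y}"
      using KF by (auto simp: K'_def)
    then have "measure M (K0 - K') \<le> measure M (K0 - K) + measure M {y \<in> K. \<not> short_column F' L' y}"
      using K0fin KF by (simp add: measure_Un_le)
    also have "\<dots> \<le> \<eta> * (1 - (1/2)^(Suc k))"
      using ms small by (simp add: algebra_simps)
    finally have "P (Suc k) (K', F', L')"
      using F' KF by (auto simp: P_def K'_def)
    moreover have "Q k s (K', F', L')"
      using F' by (simp add: Q_def s K'_def)
    ultimately show "\<exists>s'. P (Suc k) s' \<and> Q k s s'" by blast
  qed
  then obtain f where f: "\<And>k. P k (f k)" "\<And>k. Q k (f k) (f (Suc k))" by blast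
  define K where "K k = fst (f k)" for k
  define F where "F k = fst (snd (f k))" for k
  define L where "L k = snd (snd (f k))" for k
  have f_eq: "f k = (K k, F k, L k)" for k by (simp add: K_def F_def L_def)
  note P = f(1)[unfolded f_eq P_def prod.case] and Q = f(2)[unfolded f_eq Q_def prod.case]
  show thesis
  proof (rule that[of K F L])
    fix k
    have "measure M (K0 - K k) \<le> \<eta> * (1 - (1/2)^k)" using P by blast
    also have "\<dots> \<le> \<eta> * 1" using \<eta> by (intro mult_left_mono) auto
    finally show "measure M (K0 - K k) \<le> \<eta>" by simp
    show "K k \<in> sets M" "K k \<subseteq> K0" using P by blast+
    show "F (Suc k) \<subseteq> F k" "K (Suc k) = {y \<in> K k. short_column (F (Suc k)) (L (Suc k)) y}"
      "good_cuts l (K k) k (F (Suc k))"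
      using Q by blast+
  qed
qed

lemma sum_tt_shift:
  assumes "y \<in> space M"
  shows "(\<Sum>t\<in>{p..<q}. f (tt t y)) = (\<Sum>i<nat (q - p). f (tt (int i) (tt p y)))"
proof -
  have "(\<Sum>i<nat (q - p). f (tt (int i) (tt p y))) = (\<Sum>i<nat (q - p). f (tt (int i + p) y))"
    by (simp add: tt_add[OF assms])
  also have "\<dots> = (\<Sum>t\<in>{p..<q}. f (tt t y))"
    by (rule sum.reindex_bij_witness[of _ "\<lambda>t. nat (t - p)" "\<lambda>i. int i + p"]) auto
  finally show ?thesis by simp
qed

text \<open>
  A column of \<open>F (k + 1)\<close> is contained in a column of \<open>F j\<close> for every later \<open>j\<close>, so erasing treats all
  points of \<open>K k\<close> in it alike: it meets the limit set in all of them or in none. Hence the counts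
  established at stage \<open>k\<close> survive up to boundary effects.
\<close>

lemma ex_uniform_core:
  fixes \<eta> :: real
  assumes l [measurable]: "l \<in> M \<rightarrow>\<^sub>M count_space UNIV" and lN: "\<And>y. y \<in> space M \<Longrightarrow> l y \<in> {1..N}"
    and K0: "K0 \<in> sets M" "emeasure M K0 < \<infinity>"
    and \<eta>: "0 < \<eta>" "\<eta> < measure M K0"
  shows "\<exists>A\<in>sets M. A \<subseteq> K0 \<and> measure M (K0 - A) \<le> \<eta> \<and> 0 < measure M A \<and>
    (\<forall>m. \<exists>g. \<forall>y\<in>A. real m \<le> (\<Sum>t\<in>{- int g..<int g}. indicat_real A (tt t y))) \<and>
    (\<forall>I a e. finite I \<longrightarrow> 0 \<in> I \<longrightarrow> a 0 \<noteq> 1 \<longrightarrow> 0 < e \<longrightarrow>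
      (\<exists>m>0. \<forall>y\<in>space M. \<forall>u v. real m \<le> (\<Sum>t\<in>{u..<v}. indicat_real A (tt t y)) \<longrightarrow>
        \<bar>(\<Sum>t\<in>{u..<v}. indicat_real (cyl l A I a) (tt t y)) -
          measure M (cyl l A I a) / measure M A * (\<Sum>t\<in>{u..<v}. indicat_real A (tt t y))\<bar>
        \<le> e * (\<Sum>t\<in>{u..<v}. indicat_real A (tt t y))))"
proof -
  obtain K F L where Kmeas [measurable]: "\<And>k. K k \<in> sets M" and KK0: "\<And>k. K k \<subseteq> K0"
    and Kbig: "\<And>k. measure M (K0 - K k) \<le> \<eta>"
    and Fsub: "\<And>k. F (Suc k) \<subseteq> F k"
    and KSuc: "\<And>k. K (Suc k) = {y \<in> K k. short_column (F (Suc k)) (L (Suc k)) y}"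
    and good: "\<And>k. good_cuts l (K k) k (F (Suc k))"
    by (rule ex_cut_sequence[OF assms]) (assumption | rule that)+
  note [measurable] = K0(1)
  define A where "A = (\<Inter>k. K k)"
  have [measurable]: "A \<in> sets M" unfolding A_def by measurable
  have fin: "emeasure M B \<noteq> \<infinity>" if "B \<subseteq> K0" for B
    using emeasure_mono[OF that K0(1)] K0(2) by auto
  have decF: "F n \<subseteq> F m" if "m \<le> n" for m n
    using Fsub that by (rule lift_Suc_antimono_le)
  have decK: "K n \<subseteq> K m" if "m \<le> n" for m n
    using that by (rule lift_Suc_antimono_le[of K, rotated]) (auto simp: KSuc)
  have AK: "A \<subseteq> K k" for k by (auto simp: A_def)
  have AK0: "A \<subseteq> K0" using AK[of 0] KK0[of 0] by auto

  have shortK: "\<exists>p q. p \<le> t \<and> t < q \<and> q - p \<le> int (L (Suc k)) \<and> tt p y \<in> F (Suc k) \<and> tt q y \<in> F (Suc k)"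
    if y: "y \<in> space M" and t: "tt t y \<in> K (Suc k)" for y t k
  proof -
    obtain i j where "i \<le> 0" "0 < j" "j - i \<le> int (L (Suc k))"
      "tt i (tt t y) \<in> F (Suc k)" "tt j (tt t y) \<in> F (Suc k)"
      using t unfolding KSuc short_column_def by blast
    then show ?thesis
      using y by (intro exI[of _ "i + t"] exI[of _ "j + t"]) (auto simp: tt_add)
  qed

  have fill: "tt s y \<in> A"
    if y: "y \<in> space M" and uncut: "\<And>r. p < r \<Longrightarrow> r < q \<Longrightarrow> tt r y \<notin> F (Suc k)"
      and t: "p \<le> t" "t < q" "tt t y \<in> A" and s: "p \<le> s" "s < q" "tt s y \<in> K k" for y p q t s k
  proof -
    have "tt s y \<in> K (k + n)" for n
    proof (induction n)
      case (Suc n)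
      obtain i j where ij: "i \<le> t" "t < j" "j - i \<le> int (L (Suc (k + n)))"
        "tt i y \<in> F (Suc (k + n))" "tt j y \<in> F (Suc (k + n))"
        using shortK[OF y, of t "k + n"] AK[of "Suc (k + n)"] t by blast
      then have "tt i y \<in> F (Suc k)" "tt j y \<in> F (Suc k)"
        using decF[of "Suc k" "Suc (k + n)"] by auto
      \<comment> \<open>Later cuts are also cuts of \<open>F (Suc k)\<close>, so none lies strictly
        between \<open>p\<close> and \<open>q\<close>. The short column that saves the point at time
        \<open>t\<close> therefore contains time \<open>s\<close> as well.\<close>
      then have "i \<le> p" "q \<le> j"
        using uncut[of i] uncut[of j] t ij by force+
      moreover have "tt (i - s) (tt s y) = tt i y" "tt (j - s) (tt s y) = tt j y"
        using tt_add[OF y, of "i - s" s] tt_add[OF y, of "j - s" s] by auto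
      ultimately have "short_column (F (Suc (k + n))) (L (Suc (k + n))) (tt s y)"
        unfolding short_column_def using ij s by (intro exI[of _ "i - s"] exI[of _ "j - s"]) auto
      then show ?case using Suc by (simp add: KSuc)
    qed (use s in simp)
    moreover have "tt s y \<in> K j" if "j \<le> k" for j using decK[OF that] s by blast
    ultimately show ?thesis unfolding A_def by (auto simp: le_iff_add) (metis nat_le_linear le_iff_add)
  qed

  have column: "2 * (real k + 1)^2 \<le> (\<Sum>t\<in>{p..<q}. indicat_real (K k) (tt t y))"
      "C \<in> block_tests l (K k) k \<Longrightarrow> \<bar>(\<Sum>t\<in>{p..<q}. indicat_real C (tt t y)) -
        measure M C / measure M (K k) * (\<Sum>t\<in>{p..<q}. indicat_real (K k) (tt t y))\<bar>
      \<le> 1 / (real k + 1) * (\<Sum>t\<in>{p..<q}. indicat_real (K k) (tt t y))"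
    if "y \<in> space M" "p < q" "tt p y \<in> F (Suc k)" "tt q y \<in> F (Suc k)" for y p q k C
  proof -
    have "tt (int (nat (q - p))) (tt p y) = tt q y"
      using tt_add[OF that(1), of "q - p" p] that(2) by simp
    then show "2 * (real k + 1)^2 \<le> (\<Sum>t\<in>{p..<q}. indicat_real (K k) (tt t y))"
      "C \<in> block_tests l (K k) k \<Longrightarrow> \<bar>(\<Sum>t\<in>{p..<q}. indicat_real C (tt t y)) -
        measure M C / measure M (K k) * (\<Sum>t\<in>{p..<q}. indicat_real (K k) (tt t y))\<bar>
      \<le> 1 / (real k + 1) * (\<Sum>t\<in>{p..<q}. indicat_real (K k) (tt t y))"
      using good[of k, unfolded good_cuts_def, rule_format, of "tt p y" "nat (q - p)"] that
      by (auto simp: sum_tt_shift[OF that(1)])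
  qed

  have "(\<lambda>k. measure M (K k)) \<longlonglongrightarrow> measure M A"
    unfolding A_def using decK KK0 fin
    by (intro Lim_measure_decseq) (auto simp: decseq_def)
  \<comment> \<open>Since the letter 1 is allowed in words, these cylinders are not monotone in
    \<open>k\<close>. But on a finite window membership in \<open>K k\<close> is eventually
    membership in \<open>A\<close>, and all the cylinders lie in \<open>K0\<close>, so dominated
    convergence applies.\<close>
  have lim_cyl: "(\<lambda>k. measure M (cyl l (K k) I a)) \<longlonglongrightarrow> measure M (cyl l A I a)"
    if "finite I" "0 \<in> I" "a 0 \<noteq> 1" for I a
  proof -
    have "(\<lambda>k. \<integral>y. indicat_real (cyl l (K k) I a) y \<partial>M) \<longlonglongrightarrow> (\<integral>y. indicat_real (cyl l A I a) y \<partial>M)"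
    proof (rule integral_dominated_convergence)
      show "integrable M (indicat_real K0)" using K0 by auto
      show "AE y in M. norm (indicat_real (cyl l (K k) I a) y) \<le> indicat_real K0 y" for k
        using cyl_subset[of I a l "K k"] that(2,3) KK0[of k] by (auto simp: indicator_def)
      show "AE y in M. (\<lambda>k. indicat_real (cyl l (K k) I a) y) \<longlonglongrightarrow> indicat_real (cyl l A I a) y"
      proof (intro AE_I2 tendsto_eventually)
        fix y
        have "\<forall>\<^sub>F k in sequentially. (tt i y \<in> K k) = (tt i y \<in> A)" for i
        proof (cases "tt i y \<in> A")
          case False
          then obtain m where "tt i y \<notin> K m" by (auto simp: A_def)
          then have "(tt i y \<in> K k) = (tt i y \<in> A)" if "k \<ge> m" for k
            using decK[OF that] False by auto
          then show ?thesis by (auto simp: eventually_sequentially)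
        qed (use AK in \<open>auto intro!: always_eventually\<close>)
        then have "\<forall>\<^sub>F k in sequentially. \<forall>i\<in>I. (tt i y \<in> K k) = (tt i y \<in> A)"
          using that(1) by (intro eventually_ball_finite) auto
        then show "\<forall>\<^sub>F k in sequentially. indicat_real (cyl l (K k) I a) y = indicat_real (cyl l A I a) y"
          by eventually_elim (auto simp: cyl_def indicator_def)
      qed
    qed (auto simp: cyl_measurable)
    then show ?thesis by simp
  qed

  have measA: "measure M (K0 - A) \<le> \<eta>" and posA: "0 < measure M A"
  proof -
    have eq: "measure M (K0 - B) = measure M K0 - measure M B" if "B \<subseteq> K0" "B \<in> sets M" for B
      using that fin by (intro measure_Diff) auto
    have "measure M K0 - \<eta> \<le> measure M (K k)" for k
      using Kbig[of k] eq[OF KK0 Kmeas, of k] by simp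
    then have "measure M K0 - \<eta> \<le> measure M A"
      using \<open>(\<lambda>k. measure M (K k)) \<longlonglongrightarrow> measure M A\<close> by (intro LIMSEQ_le_const) auto
    then show "measure M (K0 - A) \<le> \<eta>" "0 < measure M A"
      using eq[OF AK0] \<eta> by auto
  qed

  \<comment> \<open>The radius is the height bound \<open>L (Suc m)\<close>: the column of
    \<open>F (Suc m)\<close> around \<open>y\<close> fits into this window, contains at least
    \<open>2 * (m + 1)^2\<close> points of \<open>K m\<close>, and by \<open>fill\<close> they all
    belong to \<open>A\<close>.\<close>
  have many: "\<exists>g. \<forall>y\<in>A. real m \<le> (\<Sum>t\<in>{- int g..<int g}. indicat_real A (tt t y))" for m
  proof (intro exI ballI)
    fix y assume "y \<in> A"
    then have y: "y \<in> space M" using sets.sets_into_space[of A M] by auto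
    define \<Phi> where "\<Phi> = {t. tt t y \<in> F (Suc m)}"
    obtain p q where pq: "p \<le> 0" "0 < q" "q - p \<le> int (L (Suc m))" "p \<in> \<Phi>" "q \<in> \<Phi>"
      using shortK[OF y, of 0 m] AK[of "Suc m"] \<open>y \<in> A\<close> by (auto simp: \<Phi>_def)
    \<comment> \<open>\<open>fill\<close> and its \<open>uncut\<close> hypothesis need consecutive
      cuts, hence the nearest ones: the last at a time up to 0 and the first at a time from 1
      on.\<close>
    define p' where "p' = Max (\<Phi> \<inter> {p..0})"
    define q' where "q' = Min (\<Phi> \<inter> {1..q})"
    have p': "p' \<in> \<Phi> \<inter> {p..0}" unfolding p'_def using pq by (intro Max_in) auto
    have q': "q' \<in> \<Phi> \<inter> {1..q}" unfolding q'_def using pq by (intro Min_in) auto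
    have uncut: "tt r y \<notin> F (Suc m)" if "p' < r" "r < q'" for r
    proof
      assume "tt r y \<in> F (Suc m)"
      then have r: "r \<in> \<Phi>" by (simp add: \<Phi>_def)
      show False
      proof (cases "r \<le> 0")
        case True
        then have "r \<le> p'" using r that p' unfolding p'_def by (intro Max_ge) auto
        then show False using that by simp
      next
        case False
        then have "q' \<le> r" using r that q' unfolding q'_def by (intro Min_le) auto
        then show False using that by simp
      qed
    qed
    have "real m \<le> 2 * (real m + 1)^2" by (simp add: power2_eq_square algebra_simps)
    also have "\<dots> \<le> (\<Sum>t\<in>{p'..<q'}. indicat_real (K m) (tt t y))"
      using p' q' by (intro column[OF y]) (auto simp: \<Phi>_def)
    also have "\<dots> \<le> (\<Sum>t\<in>{p'..<q'}. indicat_real A (tt t y))"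
    proof (rule sum_mono)
      fix s assume "s \<in> {p'..<q'}"
      then have "tt s y \<in> A" if "tt s y \<in> K m"
        using fill[OF y uncut, of p' q' 0 s] p' q' that \<open>y \<in> A\<close> by auto
      then show "indicat_real (K m) (tt s y) \<le> indicat_real A (tt s y)"
        by (auto simp: indicator_def)
    qed
    also have "\<dots> \<le> (\<Sum>t\<in>{- int (L (Suc m))..<int (L (Suc m))}. indicat_real A (tt t y))"
    proof (rule sum_mono2)
      show "{p'..<q'} \<subseteq> {- int (L (Suc m))..<int (L (Suc m))}"
        using p' q' pq by auto
    qed auto
    finally show "real m \<le> (\<Sum>t\<in>{- int (L (Suc m))..<int (L (Suc m))}. indicat_real A (tt t y))" .
  qed

  \<comment> \<open>One \<open>1 / (k + 1)\<close> is the error of the ratio theorem at stage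
    \<open>k\<close>, the other pays for windows that leave their column, and \<open>2 * L\<close>
    pays for the incomplete columns at the ends.\<close>
  have level: "\<bar>(\<Sum>t\<in>{u..<v}. indicat_real (cyl l A I a) (tt t y)) -
        measure M (cyl l (K k) I a) / measure M (K k) * (\<Sum>t\<in>{u..<v}. indicat_real A (tt t y))\<bar>
      \<le> 2 / (real k + 1) * (\<Sum>t\<in>{u..<v}. indicat_real A (tt t y)) + 2 * real (L (Suc k))"
    if I: "I \<subseteq> {- int k..int k}" "0 \<in> I" "a 0 \<noteq> 1" and y: "y \<in> space M" for I a k y u v
  proof -
    define C where "C = cyl l A I a"
    define C' where "C' = cyl l (K k) I a"
    define p where "p = measure M C' / measure M (K k)"
    define D where "D t = indicat_real C (tt t y) - p * indicat_real A (tt t y)" for t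
    have C'K: "C' \<subseteq> K k" unfolding C'_def using I by (intro cyl_subset) auto
    have CA: "C \<subseteq> A" unfolding C_def using I by (intro cyl_subset) auto
    have p: "0 \<le> p" "p \<le> 1"
    proof -
      have "measure M C' \<le> measure M (K k)"
        using C'K fin[OF KK0] by (intro measure_mono_fmeasurable) (auto simp: C'_def cyl_measurable fmeasurable_def less_top)
      then show "0 \<le> p" "p \<le> 1"
        using measure_nonneg[of M "K k"]
        by (simp_all add: p_def divide_le_eq_1 zero_less_measure_iff)
    qed
    have eqD: "(\<Sum>t\<in>B. D t) = (\<Sum>t\<in>B. indicat_real C (tt t y)) - p * (\<Sum>t\<in>B. indicat_real A (tt t y))" for B
      by (simp add: D_def sum_subtractf sum_distrib_left)
    have "\<bar>\<Sum>t\<in>{u..<v}. D t\<bar> \<le> 2 / (real k + 1) * (\<Sum>t\<in>{u..<v}. indicat_real A (tt t y)) + 2 * real (L (Suc k))"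
    proof (rule sum_over_columns[where \<Phi> = "{t. tt t y \<in> F (Suc k)}"])
      show "\<bar>D t\<bar> \<le> indicat_real A (tt t y)" for t
        using p CA by (auto simp: D_def indicator_def)
      show "indicat_real A (tt t y) \<le> 1" for t by (auto simp: indicator_def)
      show "\<exists>p q. p \<le> t \<and> t < q \<and> q - p \<le> int (L (Suc k)) \<and> p \<in> {t. tt t y \<in> F (Suc k)} \<and> q \<in> {t. tt t y \<in> F (Suc k)}"
        if "indicat_real A (tt t y) \<noteq> 0" for t
        using shortK[OF y, of t k] AK[of "Suc k"] that by (auto simp: indicator_def split: if_splits)
      fix r q assume rq: "r \<in> {t. tt t y \<in> F (Suc k)}" "q \<in> {t. tt t y \<in> F (Suc k)}" "r < q"
        "{r<..<q} \<inter> {t. tt t y \<in> F (Suc k)} = {}"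
      show "\<bar>\<Sum>t\<in>{r..<q}. D t\<bar> \<le> 2 / (real k + 1) * (\<Sum>t\<in>{r..<q}. indicat_real A (tt t y))"
      proof (cases "\<exists>t\<in>{r..<q}. tt t y \<in> A")
        case False
        then have "D t = 0" "indicat_real A (tt t y) = 0" if "t \<in> {r..<q}" for t
          using subsetD[OF CA, of "tt t y"] that by (auto simp: D_def indicator_def)
        then show ?thesis by simp
      next
        case True
        then obtain t where t: "r \<le> t" "t < q" "tt t y \<in> A" by auto
        have uncut: "tt s y \<notin> F (Suc k)" if "r < s" "s < q" for s
          using rq(4) that by auto
        have KA: "tt s y \<in> K k \<longleftrightarrow> tt s y \<in> A" if "s \<in> {r..<q}" for s
          using fill[OF y uncut, of r q t s] t that AK[of k] by auto
        then have eqA: "(\<Sum>s\<in>{r..<q}. indicat_real A (tt s y)) = (\<Sum>s\<in>{r..<q}. indicat_real (K k) (tt s y))"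
          by (intro sum.cong) (auto simp: indicator_def)
        let ?S = "\<Sum>s\<in>{r..<q}. indicat_real (K k) (tt s y)"
        \<comment> \<open>The times closer than \<open>k\<close> to an end of the column; at all
          other times the window stays inside it, where \<open>K k\<close> and \<open>A\<close>
          agree.\<close>
        let ?E = "{r..<r + int k} \<union> {q - int k..<q}"
        have "C' \<in> block_tests l (K k) k"
          using I unfolding C'_def block_tests_def by blast
        then have 1: "\<bar>(\<Sum>s\<in>{r..<q}. indicat_real C' (tt s y)) - p * ?S\<bar> \<le> 1 / (real k + 1) * ?S"
          and 2: "2 * (real k + 1)^2 \<le> ?S"
          using column(1)[OF y rq(3), where k = k] column(2)[OF y rq(3), where k = k and C = C'] rq(1,2)
          by (auto simp: p_def)
        have "\<bar>(\<Sum>s\<in>{r..<q}. indicat_real C (tt s y)) - (\<Sum>s\<in>{r..<q}. indicat_real C' (tt s y))\<bar>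
          \<le> (\<Sum>s\<in>{r..<q}. \<bar>indicat_real C (tt s y) - indicat_real C' (tt s y)\<bar>)"
          unfolding sum_subtractf[symmetric] by (rule sum_abs)
        also have "\<dots> \<le> (\<Sum>s\<in>{r..<q}. indicat_real ?E s)"
        proof (rule sum_mono)
          fix s assume s: "s \<in> {r..<q}"
          show "\<bar>indicat_real C (tt s y) - indicat_real C' (tt s y)\<bar> \<le> indicat_real ?E s"
          proof (cases "s \<in> ?E")
            case False
            have "tt i (tt s y) \<in> K k \<longleftrightarrow> tt i (tt s y) \<in> A" if "i \<in> I" for i
              using KA[of "i + s"] that I(1) False s by (auto simp: tt_add[OF y] subset_iff)
            then have "tt s y \<in> C \<longleftrightarrow> tt s y \<in> C'"
              by (auto simp: C_def C'_def cyl_def)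
            then show ?thesis by (simp add: indicator_def)
          qed (auto simp: indicator_def)
        qed
        also have "\<dots> = real (card ({r..<q} \<inter> ?E))"
          using Indicator_Function.sum_mult_indicator[where A = "{r..<q}" and f = "\<lambda>_. 1::real" and B = ?E] by simp
        also have "\<dots> \<le> real (card ?E)"
          by (intro of_nat_mono card_mono) auto
        also have "\<dots> \<le> 2 * real k"
          using card_Un_le[of "{r..<r + int k}" "{q - int k..<q}"] by simp
        also have "\<dots> \<le> 1 / (real k + 1) * (2 * (real k + 1)^2)"
          by (simp add: power2_eq_square)
        also have "\<dots> \<le> 1 / (real k + 1) * ?S"
          using 2 by (intro mult_left_mono) auto
        finally have "\<bar>(\<Sum>s\<in>{r..<q}. indicat_real C (tt s y)) - p * ?S\<bar> \<le> 1 / (real k + 1) * ?S + 1 / (real k + 1) * ?S"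
          using 1 by linarith
        then show ?thesis unfolding eqD eqA by simp
      qed
    qed simp
    then show ?thesis unfolding eqD p_def C_def C'_def .
  qed

  have uniform: "\<exists>m>0. \<forall>y\<in>space M. \<forall>u v. real m \<le> (\<Sum>t\<in>{u..<v}. indicat_real A (tt t y)) \<longrightarrow>
        \<bar>(\<Sum>t\<in>{u..<v}. indicat_real (cyl l A I a) (tt t y)) -
          measure M (cyl l A I a) / measure M A * (\<Sum>t\<in>{u..<v}. indicat_real A (tt t y))\<bar>
        \<le> e * (\<Sum>t\<in>{u..<v}. indicat_real A (tt t y))"
    if I: "finite I" "0 \<in> I" "a 0 \<noteq> 1" and e: "0 < e" for I a e
  proof -
    define p where "p = measure M (cyl l A I a) / measure M A"
    define p' where "p' k = measure M (cyl l (K k) I a) / measure M (K k)" for k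
    have "p' \<longlonglongrightarrow> p"
      unfolding p_def p'_def
      using lim_cyl[of I a] I \<open>(\<lambda>k. measure M (K k)) \<longlonglongrightarrow> measure M A\<close> posA by (intro tendsto_divide) auto
    then have "\<forall>\<^sub>F k in sequentially. dist (p' k) p < e / 3"
      using e by (intro tendstoD) auto
    moreover have "\<forall>\<^sub>F k in sequentially. 2 / (real k + 1) < e / 3"
    proof -
      have "\<forall>\<^sub>F k in sequentially. 6 / e < real k"
        using filterlim_real_sequentially by (simp add: filterlim_at_top_dense)
      then show ?thesis
      proof eventually_elim
        case (elim k)
        then show ?case using e by (simp add: field_simps)
      qed
    qed
    moreover have "\<forall>\<^sub>F k in sequentially. \<forall>i\<in>I. \<bar>i\<bar> \<le> int k"
    proof (intro eventually_ball_finite ballI I(1))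
      fix i
      show "\<forall>\<^sub>F k in sequentially. \<bar>i\<bar> \<le> int k"
        using eventually_ge_at_top[of "nat \<bar>i\<bar>"] by eventually_elim linarith
    qed
    ultimately have "\<forall>\<^sub>F k in sequentially. dist (p' k) p < e / 3 \<and> 2 / (real k + 1) < e / 3 \<and> (\<forall>i\<in>I. \<bar>i\<bar> \<le> int k)"
      by eventually_elim blast
    then obtain k where k: "\<bar>p' k - p\<bar> < e / 3" "2 / (real k + 1) < e / 3" "\<forall>i\<in>I. \<bar>i\<bar> \<le> int k"
      by (auto simp: eventually_sequentially dist_real_def)
    have Ik: "I \<subseteq> {- int k..int k}" using k(3) by force
    \<comment> \<open>With this many visits the end error \<open>2 * L\<close> is at most
      \<open>e / 3\<close> per visit. The other two thirds go to the relative error at stage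
      \<open>k\<close> and to the distance of \<open>p' k\<close> from its limit
      \<open>p\<close>.\<close>
    obtain m :: nat where m: "6 * real (L (Suc k)) / e \<le> real m" using real_arch_simple by blast
    show ?thesis
    proof (intro exI[of _ "Suc m"] conjI ballI allI impI)
      fix y u v assume y: "y \<in> space M"
      let ?S = "\<Sum>t\<in>{u..<v}. indicat_real A (tt t y)"
      let ?C = "\<Sum>t\<in>{u..<v}. indicat_real (cyl l A I a) (tt t y)"
      assume S: "real (Suc m) \<le> ?S"
      have S0: "0 \<le> ?S" by (intro sum_nonneg) auto
      have 1: "\<bar>?C - p' k * ?S\<bar> \<le> 2 / (real k + 1) * ?S + 2 * real (L (Suc k))"
        unfolding p'_def using Ik I(2,3) y by (rule level)
      have 2: "2 / (real k + 1) * ?S \<le> e / 3 * ?S" using k(2) S0 by (intro mult_right_mono) auto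
      have "6 * real (L (Suc k)) / e \<le> ?S" using m S by simp
      then have 3: "2 * real (L (Suc k)) \<le> e / 3 * ?S" using e by (simp add: field_simps)
      have "\<bar>p' k * ?S - p * ?S\<bar> = \<bar>p' k - p\<bar> * ?S"
        using S0 by (simp add: abs_mult left_diff_distrib[symmetric])
      also have "\<dots> \<le> e / 3 * ?S" using k(1) S0 by (intro mult_right_mono) auto
      finally have "\<bar>?C - p * ?S\<bar> \<le> e / 3 * ?S + e / 3 * ?S + e / 3 * ?S"
        using 1 2 3 by linarith
      then show "\<bar>?C - measure M (cyl l A I a) / measure M A * ?S\<bar> \<le> e * ?S"
        by (simp add: p_def)
    qed simp
  qed

  show ?thesis
    using AK0 measA posA many uniform by (intro bexI[of _ A]) auto
qed

end

text \<open>Countably many half-open intervals of length \<delta>, pulled back by the isomorphism,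
  cover \<open>W\<close> up to a null set, so one of them meets \<open>W\<close> in positive
  measure. As \<delta> is below the measure of \<open>W\<close>, it cannot exhaust \<open>W\<close>.
  No finiteness of \<open>W\<close> is required.\<close>

lemma infinite_lebesgue_space_splits:
  assumes M: "infinite_lebesgue_space M" and W [measurable]: "W \<in> sets M" and pos: "emeasure M W > 0"
  shows "\<exists>V\<in>sets M. V \<subseteq> W \<and> emeasure M V > 0 \<and> emeasure M (W - V) > 0"
proof -
  obtain A B and f :: "'a \<Rightarrow> real" where A: "A \<in> null_sets M" and B: "B \<in> null_sets lebesgue"
    and iso: "measure_iso (restrict_space M (space M - A)) (restrict_space lebesgue (- B)) f"
    using M by (auto simp: infinite_lebesgue_space_def)
  have [measurable]: "A \<in> sets M" "B \<in> sets lebesgue" using A B by auto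
  let ?R = "restrict_space M (space M - A)"
  let ?S = "restrict_space lebesgue (- B)"
  have spR: "space ?R = space M - A" by (auto simp: space_restrict_space)
  have f: "f \<in> ?R \<rightarrow>\<^sub>M ?S" "\<And>E. E \<in> sets ?S \<Longrightarrow> emeasure ?R (f -` E \<inter> space ?R) = emeasure ?S E"
    using iso by (auto simp: measure_iso_def)
  have piece: "{y \<in> space M - A. f y \<in> J} \<in> sets M"
      "emeasure M {y \<in> space M - A. f y \<in> J} \<le> emeasure lborel J" if J: "J \<in> sets borel" for J
  proof -
    have E: "J - B \<in> sets ?S"
      using J by (auto simp: sets_restrict_space image_iff intro!: bexI[of _ J])
    have eq: "f -` (J - B) \<inter> space ?R = {y \<in> space M - A. f y \<in> J}"
      using measurable_space[OF f(1)] by (auto simp: spR space_restrict_space)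
    have "{y \<in> space M - A. f y \<in> J} \<in> sets ?R"
      using measurable_sets[OF f(1) E] unfolding eq .
    then show meas: "{y \<in> space M - A. f y \<in> J} \<in> sets M"
      by (auto simp: sets_restrict_space_iff)
    have "emeasure M {y \<in> space M - A. f y \<in> J} = emeasure ?R {y \<in> space M - A. f y \<in> J}"
      by (subst emeasure_restrict_space) auto
    also have "\<dots> = emeasure ?S (J - B)" using f(2)[OF E] unfolding eq .
    also have "\<dots> = emeasure lebesgue (J - B)"
      by (subst emeasure_restrict_space) (auto simp: Compl_eq_Diff_UNIV)
    also have "\<dots> \<le> emeasure lebesgue J"
      using J by (intro emeasure_mono) auto
    also have "\<dots> = emeasure lborel J" using J by simp
    finally show "emeasure M {y \<in> space M - A. f y \<in> J} \<le> emeasure lborel J" .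
  qed
  obtain c where c: "0 < c" "c < emeasure M W" using dense[OF pos] by blast
  then obtain \<delta> where \<delta>: "c = ennreal \<delta>" "\<delta> > 0" by (cases c) auto
  define P where "P k = W \<inter> {y \<in> space M - A. f y \<in> {of_int k * \<delta>..<(of_int k + 1) * \<delta>}}" for k :: int
  have [measurable]: "P k \<in> sets M" for k
    unfolding P_def by (intro sets.Int W piece) auto
  have "W \<subseteq> A \<union> (\<Union>k. P k)"
  proof
    fix y assume "y \<in> W"
    moreover have "of_int \<lfloor>f y / \<delta>\<rfloor> * \<delta> \<le> f y" "f y < (of_int \<lfloor>f y / \<delta>\<rfloor> + 1) * \<delta>"
      using \<delta>(2) by (simp_all add: pos_le_divide_eq[symmetric] pos_divide_less_eq[symmetric] floor_correct)
    ultimately show "y \<in> A \<union> (\<Union>k. P k)"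
      using sets.sets_into_space[OF W] by (auto simp: P_def)
  qed
  have "\<exists>k. emeasure M (P k) > 0"
  proof (rule ccontr)
    assume "\<not> ?thesis"
    then have "P k \<in> null_sets M" for k by (auto simp: null_sets_def)
    then have "A \<union> (\<Union>k. P k) \<in> null_sets M" using A by auto
    then have "emeasure M W = 0"
      using \<open>W \<subseteq> _\<close> by (metis W null_sets_subset null_setsD1)
    then show False using pos by simp
  qed
  then obtain k where k: "emeasure M (P k) > 0" by blast
  have "P k \<subseteq> W" by (auto simp: P_def)
  have "emeasure M (P k) \<le> emeasure M {y \<in> space M - A. f y \<in> {of_int k * \<delta>..<(of_int k + 1) * \<delta>}}"
    by (intro emeasure_mono piece) (auto simp: P_def)
  also have "\<dots> \<le> emeasure lborel {of_int k * \<delta>..<(of_int k + 1) * \<delta>}"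
    by (intro piece) auto
  also have "\<dots> = c"
    using \<delta> by (simp add: algebra_simps)
  finally have "emeasure M (P k) < emeasure M W" using c by simp
  moreover have "emeasure M W \<le> emeasure M (P k) + emeasure M (W - P k)"
    using emeasure_subadditive[of "P k" M "W - P k"] \<open>P k \<subseteq> W\<close> by (simp add: Un_absorb1)
  ultimately have "emeasure M (W - P k) > 0"
    by (metis add.right_neutral leD not_gr_zero)
  moreover note \<open>P k \<subseteq> W\<close>
  ultimately show ?thesis using k by (intro bexI[of _ "P k"] conjI) measurable
qed

section \<open>The symbolic factor\<close>

locale partition_system = ergodic_infinite M T
  for M :: "'a measure" and T :: "'a \<Rightarrow> 'a" +
  fixes N :: nat and \<alpha> :: "nat \<Rightarrow> 'a set"
  assumes fp: "finite_partition M N \<alpha>"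
begin

abbreviation "itin \<equiv> itinerary M T N \<alpha>"
abbreviation "K \<equiv> fin_core M \<alpha>"
abbreviation "X \<equiv> symbolic_space M T N \<alpha>"

lemma atom_sets [measurable]: "j \<in> {1..N} \<Longrightarrow> \<alpha> j \<in> sets M"
  using fp by (auto simp: finite_partition_def)

lemma N2: "N \<ge> 2" using fp by (auto simp: finite_partition_def)

lemma K_sets [measurable]: "K \<in> sets M"
  using atom_sets[of 1] N2 by (auto simp: fin_core_def)

lemma itin_iff: "y \<in> space M \<Longrightarrow> itin y i = j \<longleftrightarrow> j \<in> {1..N} \<and> tt i y \<in> \<alpha> j"
proof -
  assume y: "y \<in> space M"
  have un: "(\<Union>i\<in>{1..N}. \<alpha> i) = space M" and disj: "disjoint_family_on \<alpha> {1..N}"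
    using fp unfolding finite_partition_def by blast+
  have ex1: "\<exists>!j. j \<in> {1..N} \<and> tt i y \<in> \<alpha> j"
  proof (rule ex_ex1I)
    show "\<exists>j. j \<in> {1..N} \<and> tt i y \<in> \<alpha> j"
      using un tt_space[OF y, of i] by blast
    show "j = j'" if "j \<in> {1..N} \<and> tt i y \<in> \<alpha> j" "j' \<in> {1..N} \<and> tt i y \<in> \<alpha> j'" for j j'
      using disjoint_family_onD[OF disj, of j j'] that by blast
  qed
  have "itin y i \<in> {1..N} \<and> tt i y \<in> \<alpha> (itin y i)"
    unfolding itinerary_def by (rule theI'[OF ex1])
  then show ?thesis using ex1 by blast
qed

lemma itin_range: "y \<in> space M \<Longrightarrow> itin y i \<in> {1..N}"
  using itin_iff[of y i "itin y i"] by simp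

lemma itin_neq_1: "y \<in> space M \<Longrightarrow> itin y i \<noteq> 1 \<longleftrightarrow> tt i y \<in> K"
  using N2 itin_iff[of y i 1] by (auto simp: fin_core_def)

lemma itin_tt: "y \<in> space M \<Longrightarrow> itin (tt k y) i = itin y (i + k)"
  by (simp add: itinerary_def tt_add)

lemma fin_core_UN: "K = (\<Union>j\<in>{1..N} - {1}. \<alpha> j)"
proof -
  have un: "(\<Union>i\<in>{1..N}. \<alpha> i) = space M" and disj: "disjoint_family_on \<alpha> {1..N}"
    using fp unfolding finite_partition_def by blast+
  have "\<alpha> j \<subseteq> - \<alpha> 1" if "j \<in> {1..N} - {1}" for j
    using disjoint_family_onD[OF disj, of j 1] that N2 by auto
  moreover have "{1..N} = insert 1 ({1..N} - {1})" using N2 by auto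
  then have "(\<Union>i\<in>{1..N}. \<alpha> i) = \<alpha> 1 \<union> (\<Union>j\<in>{1..N} - {1}. \<alpha> j)" by (metis UN_insert)
  ultimately show ?thesis
    unfolding fin_core_def un[symmetric] by blast
qed

lemma K_pos: "emeasure M K > 0"
  and K_fin: "emeasure M K < \<infinity>"
proof -
  show "emeasure M K > 0" using fp by (auto simp: finite_partition_def)
  have "emeasure M K \<le> (\<Sum>j\<in>{1..N} - {1}. emeasure M (\<alpha> j))"
    unfolding fin_core_UN by (intro emeasure_subadditive_finite) auto
  also have "\<dots> < \<infinity>"
    using fp by (auto simp: finite_partition_def)
  finally show "emeasure M K < \<infinity>" .
qed

lemma itin_measurable_count [measurable]: "(\<lambda>y. itin y i) \<in> M \<rightarrow>\<^sub>M count_space UNIV"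
proof (rule measurable_count_space_eq_countable[THEN iffD2], simp, safe)
  fix j
  have "(\<lambda>y. itin y i) -` {j} \<inter> space M = (if j \<in> {1..N} then tt i -` \<alpha> j \<inter> space M else {})"
    using itin_iff by auto
  then show "(\<lambda>y. itin y i) -` {j} \<inter> space M \<in> sets M"
    by simp
qed simp

lemma itin_measurable [measurable]: "itin \<in> M \<rightarrow>\<^sub>M borel"
proof (rule measurable_coordinatewise_then_product)
  fix i
  show "(\<lambda>y. itin y i) \<in> borel_measurable M"
    using itin_measurable_count[of i] by (simp add: measurable_cong_sets[OF refl sets_borel_eq_count_space])
qed

lemma symbolic_measure_eq:
  "U \<in> sets borel \<Longrightarrow> emeasure (symbolic_measure M T N \<alpha>) U = emeasure M {y \<in> space M. itin y \<in> U}"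
  by (simp add: symbolic_measure_def emeasure_distr vimage_def Int_def conj_commute)

text \<open>A finite word defines an open set in the product of discrete spaces. If it were null,
  its complement would be one of the closed sets whose intersection is the support.\<close>

lemma support_word_pos:
  assumes x: "x \<in> measure_support (symbolic_measure M T N \<alpha>)" and J: "finite J"
  shows "emeasure M {y \<in> space M. \<forall>i\<in>J. itin y i = x i} > 0"
proof (rule ccontr)
  assume null: "\<not> ?thesis"
  define U where "U = (\<Inter>i\<in>J. (\<lambda>z::int \<Rightarrow> nat. z i) -` {x i})"
  have "open U"
    unfolding U_def using J
    by (intro open_INT ballI open_vimage) (auto intro: open_discrete continuous_on_product_coordinates)
  then have "emeasure (symbolic_measure M T N \<alpha>) U = emeasure M {y \<in> space M. itin y \<in> U}"
    by (intro symbolic_measure_eq) auto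
  also have "\<dots> = 0" using null by (simp add: U_def)
  finally have "- U \<in> {F. closed F \<and> emeasure (symbolic_measure M T N \<alpha>) (- F) = 0}"
    using \<open>open U\<close> by (simp add: closed_def)
  then have "x \<in> - U" using x unfolding measure_support_def by blast
  then show False by (auto simp: U_def)
qed

text \<open>The shift is continuous and corresponds under \<open>itin\<close> to an iterate of
  \<open>T\<close>, which preserves the measure. So the preimage of a closed set of full measure is
  again such a set.\<close>

lemma support_shift:
  assumes x: "x \<in> measure_support (symbolic_measure M T N \<alpha>)"
  shows "(\<lambda>i. x (i + k)) \<in> measure_support (symbolic_measure M T N \<alpha>)"
  unfolding measure_support_def
proof safe
  fix F :: "(int \<Rightarrow> nat) set" assume F: "closed F" "emeasure (symbolic_measure M T N \<alpha>) (- F) = 0"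
  have [measurable]: "F \<in> sets borel" using F(1) by (rule borel_closed)
  define s where "s = (\<lambda>(z::int \<Rightarrow> nat) i. z (i + k))"
  have cont: "continuous_on UNIV s"
    unfolding s_def by (intro continuous_on_coordinatewise_then_product continuous_on_product_coordinates)
  then have cl: "closed (s -` F)" using F(1) by (intro closed_vimage) auto
  have "emeasure (symbolic_measure M T N \<alpha>) (- (s -` F)) = emeasure M {y \<in> space M. itin y \<in> - (s -` F)}"
    using cl by (intro symbolic_measure_eq) auto
  also have "{y \<in> space M. itin y \<in> - (s -` F)} = tt k -` {y \<in> space M. itin y \<in> - F} \<inter> space M"
  proof -
    have "itin (tt k y) = s (itin y)" if "y \<in> space M" for y
      using itin_tt[OF that] by (auto simp: s_def)
    then show ?thesis by auto
  qed
  also have "emeasure M \<dots> = emeasure M {y \<in> space M. itin y \<in> - F}"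
    by (intro tt_preserve) measurable
  also have "\<dots> = 0" using F(2) by (subst (asm) symbolic_measure_eq) auto
  finally have "x \<in> s -` F" using x cl unfolding measure_support_def by blast
  then show "(\<lambda>i. x (i + k)) \<in> F" by (simp add: s_def)
qed

lemma X_shift: "x \<in> X \<Longrightarrow> (\<lambda>i. x (i + k)) \<in> X"
  unfolding symbolic_space_def
proof safe
  assume "(\<lambda>i. x (i + k)) = (\<lambda>_. 1)"
  then have "x i = 1" for i by (metis diff_add_cancel)
  moreover assume "x \<notin> {}" "x \<noteq> (\<lambda>_. 1)"
  ultimately show False by blast
qed (use support_shift in auto)

text \<open>For negative \<open>k\<close> the iterate uses the inverse of the shift on
  \<open>X\<close>, so it has to be known first that the shift is a bijection of
  \<open>X\<close>.\<close>

lemma iter_left_shift: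
  assumes x: "x \<in> X"
  shows "iter_int X left_shift k x = (\<lambda>i. x (i + k))"
proof -
  have inj: "z = w" if "left_shift z = left_shift w" for z w :: "int \<Rightarrow> nat"
  proof
    fix i show "z i = w i" using fun_cong[OF that, of "i - 1"] by (simp add: left_shift_def)
  qed
  have bijX: "bij_betw left_shift X X"
    unfolding bij_betw_def
  proof safe
    show "inj_on left_shift X" using inj by (auto simp: inj_on_def)
    show "left_shift z \<in> X" if "z \<in> X" for z using X_shift[OF that, of 1] by (simp add: left_shift_def)
    show "z \<in> left_shift ` X" if "z \<in> X" for z
      using X_shift[OF that, of "-1"] by (intro image_eqI[of _ _ "\<lambda>i. z (i + -1)"]) (auto simp: left_shift_def)
  qed
  note st = iter_int_step(2)[OF bijX x]
  show ?thesis
  proof (induction k rule: int_induct[where k = 0])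
    case (step1 k)
    have "iter_int X left_shift (k + 1) x = left_shift (\<lambda>i. x (i + k))"
      using st[of k] step1 by simp
    also have "\<dots> = (\<lambda>i. x (i + (k + 1)))" by (simp add: left_shift_def algebra_simps)
    finally show ?case .
  next
    case (step2 k)
    have "left_shift (iter_int X left_shift (k - 1) x) = left_shift (\<lambda>i. x (i + (k - 1)))"
      using st[of "k - 1"] step2 by (simp add: left_shift_def)
    then show ?case by (rule inj)
  qed simp
qed

section \<open>From almost every point of the system to every point of the symbolic space\<close>

lemma AE_pos_ex:
  assumes [measurable]: "A \<in> sets M" and "emeasure M A > 0" and AE: "AE y in M. P y"
  shows "\<exists>y\<in>A. P y"
proof (rule ccontr)
  assume neg: "\<not> ?thesis"
  have "AE y in M. y \<notin> A"
    using AE by eventually_elim (use neg in blast)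
  then show False using AE_iff_null_sets[OF assms(1)] assms(2) by auto
qed

text \<open>Any finite part of \<open>x\<close> is read along a set of orbits of positive measure,
  so some of these orbits also satisfy a property that holds almost everywhere. This is how the
  pointwise bounds reach exceptional points of \<open>X\<close>.\<close>

lemma support_ex_point:
  assumes "x \<in> X" "finite J" "AE y in M. P y"
  obtains y where "y \<in> space M" "P y" "\<And>i. i \<in> J \<Longrightarrow> itin y i = x i"
proof -
  have "{y \<in> space M. \<forall>i\<in>J. itin y i = x i} \<in> sets M"
    using assms(2) by measurable
  then show thesis
    using AE_pos_ex[of "{y \<in> space M. \<forall>i\<in>J. itin y i = x i}" P] support_word_pos[of x J] assms that
    by (auto simp: symbolic_space_def)
qed

lemma sum_indicator_tt:
  "finite B \<Longrightarrow> (\<Sum>t\<in>B. indicat_real A (tt t y)) = real (card {t \<in> B. tt t y \<in> A})"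
  by (simp add: indicator_def of_bool_def sum.If_cases Int_def)

text \<open>Centre \<open>x\<close> at a letter other than 1 and copy the window of radius
  \<open>g\<close> by an orbit that starts in \<open>K\<close>. Its \<open>m\<close> visits inside
  the window are letters other than 1 of \<open>x\<close>, and \<open>m\<close> was chosen larger
  than their supposed number.\<close>

lemma infinitely_many_non_1:
  assumes many: "\<And>m. \<exists>g. AE y in M. y \<in> K \<longrightarrow> real m \<le> (\<Sum>t\<in>{- int g..<int g}. indicat_real K (tt t y))"
    and x: "x \<in> X"
  shows "infinite {k. x k \<noteq> 1}"
proof
  assume fin: "finite {k. x k \<noteq> 1}"
  obtain k0 where k0: "x k0 \<noteq> 1" using x by (auto simp: symbolic_space_def)
  define m where "m = Suc (card {k. x k \<noteq> 1})"
  obtain g where g: "AE y in M. y \<in> K \<longrightarrow> real m \<le> (\<Sum>t\<in>{- int g..<int g}. indicat_real K (tt t y))"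
    using many by blast
  obtain y where y: "y \<in> space M" "y \<in> K \<longrightarrow> real m \<le> (\<Sum>t\<in>{- int g..<int g}. indicat_real K (tt t y))"
    "\<And>i. i \<in> {- int g..<int g} \<union> {0} \<Longrightarrow> itin y i = x (i + k0)"
    by (rule support_ex_point[OF X_shift[OF x, of k0] _ g, of "{- int g..<int g} \<union> {0}"]) auto
  have "y \<in> K" using itin_neq_1[OF y(1), of 0] y(3)[of 0] k0 by simp
  then have "real m \<le> real (card {t \<in> {- int g..<int g}. tt t y \<in> K})"
    using y(2) by (simp add: sum_indicator_tt)
  moreover have "card {t \<in> {- int g..<int g}. tt t y \<in> K} \<le> card {k. x k \<noteq> 1}"
  proof (rule card_inj_on_le[OF _ _ fin])
    show "inj_on (\<lambda>t. t + k0) {t \<in> {- int g..<int g}. tt t y \<in> K}" by (simp add: inj_on_def)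
    show "(\<lambda>t. t + k0) ` {t \<in> {- int g..<int g}. tt t y \<in> K} \<subseteq> {k. x k \<noteq> 1}"
      using itin_neq_1[OF y(1)] y(3) by force
  qed
  ultimately show False by (simp add: m_def)
qed

text \<open>
  By ergodicity and infinite measure, the set of points with a given periodic itinerary is null, so
  long words of \<open>x\<close> have small measure; uniformity would give them frequency at least \<open>1 / p\<close>.
\<close>

lemma not_periodic:
  assumes unif: "uniform_partition M T N \<alpha> K"
    and x: "x \<in> X" "x 0 \<noteq> 1" and p: "p > 0" and per: "\<And>i. x (i + int p) = x i"
  shows False
proof -
  have per': "x (i + int p * q) = x i" for i q
  proof (induction q rule: int_induct[where k = 0])
    case (step1 q)
    then show ?case using per[of "i + int p * q"] by (simp add: algebra_simps)
  next
    case (step2 q)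
    then show ?case using per[of "i + int p * (q - 1)"] by (simp add: algebra_simps)
  qed simp
  define C where "C j = {y \<in> space M. \<forall>i\<in>{- int j..<int j}. itin y i = x i}" for j
  define E where "E = {y \<in> space M. \<forall>i. itin y i = x i}"
  have [measurable]: "C j \<in> sets M" "E \<in> sets M" for j unfolding C_def E_def by measurable
  have CK: "C j \<subseteq> K" if "j > 0" for j
    using that x(2) itin_neq_1[of _ 0] by (force simp: C_def)
  have fin: "emeasure M (C (Suc j)) < \<infinity>" for j
    using emeasure_mono[OF CK[of "Suc j"] K_sets] K_fin by auto
  have EC: "E = (\<Inter>j. C (Suc j))"
  proof -
    have "y \<in> E" if "y \<in> (\<Inter>j. C (Suc j))" for y
    proof -
      have "itin y i = x i" for i
      proof -
        have "y \<in> C (Suc (nat \<bar>i\<bar>))" using that by blast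
        moreover have "i \<in> {- int (Suc (nat \<bar>i\<bar>))..<int (Suc (nat \<bar>i\<bar>))}" by auto
        ultimately show ?thesis unfolding C_def by blast
      qed
      then show ?thesis using that by (auto simp: E_def C_def)
    qed
    then show ?thesis by (auto simp: E_def C_def)
  qed
  have Efin: "emeasure M E < \<infinity>"
  proof -
    have "E \<subseteq> C (Suc 0)" unfolding EC by auto
    then show ?thesis using emeasure_mono[of E "C (Suc 0)" M] fin[of 0] by auto
  qed
  have E0: "emeasure M E = 0"
  proof (rule ccontr)
    assume "emeasure M E \<noteq> 0"
    then have "AE y in M. \<exists>i. tt i y \<in> E"
      by (intro AE_visit) (auto simp: zero_less_iff_neq_zero)
    \<comment> \<open>By periodicity visits to \<open>E\<close> recur modulo \<open>p\<close>, so
      \<open>p\<close> translates of \<open>E\<close> would cover almost all of the space, whose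
      measure is infinite.\<close>
    then have "AE y in M. y \<in> (\<Union>r\<in>{0..<int p}. tt r -` E \<inter> space M)"
      using AE_space
    proof eventually_elim
      case (elim y)
      then obtain i where i: "tt i y \<in> E" by blast
      have "itin (tt (i mod int p) y) t = x t" for t
      proof -
        have "itin (tt (i mod int p) y) t = itin (tt i y) (t + i mod int p - i)"
          using elim(2) by (simp add: itin_tt)
        also have "\<dots> = x (t + i mod int p - i)" using i by (auto simp: E_def)
        also have "t + i mod int p - i = t + int p * (- (i div int p))"
          by (simp add: algebra_simps minus_mult_div_eq_mod[symmetric])
        finally show ?thesis by (simp only: per')
      qed
      then have "tt (i mod int p) y \<in> E" using elim(2) by (auto simp: E_def)
      moreover have "i mod int p \<in> {0..<int p}" using p by auto
      ultimately show ?case using elim(2) by blast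
    qed
    then have "emeasure M (space M) \<le> emeasure M (\<Union>r\<in>{0..<int p}. tt r -` E \<inter> space M)"
      by (intro emeasure_mono_AE) auto
    also have "\<dots> \<le> (\<Sum>r\<in>{0..<int p}. emeasure M (tt r -` E \<inter> space M))"
      by (intro emeasure_subadditive_finite) auto
    also have "\<dots> < \<infinity>"
      using Efin by (simp add: tt_preserve ennreal_mult_less_top of_nat_less_top)
    finally show False using inf_space by simp
  qed
  have "(\<lambda>j. measure M (C (Suc j))) \<longlonglongrightarrow> measure M E"
    unfolding EC using fin by (intro Lim_measure_decseq) (auto simp: decseq_def C_def less_top)
  then have "(\<lambda>j. measure M (C (Suc j))) \<longlonglongrightarrow> 0"
    using E0 by (simp add: measure_def)
  moreover have Kpos: "measure M K > 0"
    using K_pos K_fin by (auto simp: measure_def enn2real_positive_iff)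
  \<comment> \<open>The factor 4 leaves room for two errors of \<open>1 / (4 * p)\<close>: this
    relative measure and the tolerance taken from uniformity. The frequency would be below
    \<open>1 / (2 * p)\<close>.\<close>
  ultimately have "\<forall>\<^sub>F j in sequentially. measure M (C (Suc j)) < measure M K / (4 * real p)"
    using p by (intro order_tendstoD) auto
  then obtain j0 where j0: "measure M (C (Suc j0)) < measure M K / (4 * real p)"
    by (auto simp: eventually_sequentially)
  define j where "j = Suc j0"
  have xr: "x i \<in> {1..N}" for i
  proof -
    obtain y where "y \<in> space M" "True" "\<And>k. k \<in> {i} \<Longrightarrow> itin y k = x k"
      by (rule support_ex_point[OF x(1), of "{i}" "\<lambda>_. True"]) auto
    then show ?thesis using itin_range[of y i] by simp
  qed
  have "C j \<in> part_join M T N \<alpha> (- int j) (int j - 1)"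
    unfolding part_join_def
  proof (intro CollectI exI conjI ballI)
    show "C j = (\<Inter>i\<in>{- int j..int j - 1}. tt i -` \<alpha> (x i) \<inter> space M)"
      using xr by (auto simp: C_def j_def itin_iff)
  qed (use xr in auto)
  moreover have "C j \<in> pos_fin_sets M"
    using fin[of j0] support_word_pos[of x "{- int j..<int j}"] x(1)
    unfolding pos_fin_sets_def by (auto simp: j_def C_def symbolic_space_def)
  moreover have "1 \<le> j" by (simp add: j_def)
  ultimately have "uniform_set M T K (C j)"
    using unif unfolding uniform_partition_def by blast
  moreover have "0 < 1 / (4 * real p)" using p by simp
  ultimately obtain m where m: "0 < m" "AE y in M. y \<in> K \<longrightarrow> (\<forall>n. birkhoff_sum M T n (indicator K) y \<ge> real m \<longrightarrow>
      \<bar>birkhoff_sum M T n (indicator (C j)) y / birkhoff_sum M T n (indicator K) y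
        - measure M (C j) / measure M K\<bar> < 1 / (4 * real p))"
    unfolding uniform_set_def by blast
  \<comment> \<open>Among the \<open>2 * p * m\<close> times from \<open>-n\<close> to
    \<open>n - 1\<close> there are \<open>2 * m\<close> multiples of \<open>p\<close>, at each of
    which the word recurs. So the frequency of the word is at least \<open>1 / p\<close>, and there
    are enough visits to \<open>K\<close> for uniformity to apply.\<close>
  define n where "n = p * m"
  obtain y where y: "y \<in> space M" "y \<in> K \<longrightarrow> (\<forall>n. birkhoff_sum M T n (indicator K) y \<ge> real m \<longrightarrow>
      \<bar>birkhoff_sum M T n (indicator (C j)) y / birkhoff_sum M T n (indicator K) y
        - measure M (C j) / measure M K\<bar> < 1 / (4 * real p))"
    and word: "\<And>i. i \<in> {- int n - int j..<int n + int j} \<Longrightarrow> itin y i = x i"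
    by (rule support_ex_point[OF x(1) _ m(2), of "{- int n - int j..<int n + int j}"]) auto
  have "y \<in> K"
    using itin_neq_1[OF y(1), of 0] word[of 0] x(2) by (auto simp: j_def)
  let ?S = "birkhoff_sum M T n (indicator K) y"
  let ?c = "birkhoff_sum M T n (indicator (C j)) y"
  have S: "?S = real (card {t \<in> {- int n..int n - 1}. tt t y \<in> K})"
    and c: "?c = real (card {t \<in> {- int n..int n - 1}. tt t y \<in> C j})"
    by (simp_all add: birkhoff_sum_def sum_indicator_tt)
  have "card {- int m..<int m} \<le> card {t \<in> {- int n..int n - 1}. tt t y \<in> C j}"
  proof (rule card_inj_on_le[of "\<lambda>q. int p * q"])
    show "inj_on (\<lambda>q. int p * q) {- int m..<int m}" using p by (auto simp: inj_on_def)
    show "(\<lambda>q. int p * q) ` {- int m..<int m} \<subseteq> {t \<in> {- int n..int n - 1}. tt t y \<in> C j}"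
    proof safe
      fix q assume q: "q \<in> {- int m..<int m}"
      have "int p * (- int m) \<le> int p * q" "int p * q \<le> int p * (int m - 1)"
        using q by (intro mult_left_mono; simp)+
      then have r: "- int n \<le> int p * q" "int p * q \<le> int n - int p" by (simp_all add: n_def algebra_simps)
      then show "int p * q \<in> {- int n..int n - 1}" using p by auto
      have "itin (tt (int p * q) y) i = x i" if "i \<in> {- int j..<int j}" for i
      proof -
        have "itin (tt (int p * q) y) i = x (i + int p * q)"
          using r that p y(1) by (subst itin_tt) (auto intro!: word)
        then show ?thesis using per' by simp
      qed
      then show "tt (int p * q) y \<in> C j" using y(1) by (auto simp: C_def)
    qed
    show "finite {t \<in> {- int n..int n - 1}. tt t y \<in> C j}"
      by (rule finite_subset[of _ "{- int n..int n - 1}"]) auto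
  qed
  then have c2: "2 * real m \<le> ?c" unfolding c by simp
  have "?c \<le> ?S" unfolding c S using CK[of j]
    by (intro of_nat_mono card_mono finite_subset[of "{t \<in> {- int n..int n - 1}. tt t y \<in> K}" "{- int n..int n - 1}"])
      (auto simp: j_def)
  moreover have "?S \<le> 2 * real n"
  proof -
    have "card {t \<in> {- int n..int n - 1}. tt t y \<in> K} \<le> card {- int n..int n - 1}"
      by (intro card_mono) auto
    then show ?thesis unfolding S by simp
  qed
  ultimately have S2: "real m \<le> ?S" "?S > 0" "?S \<le> 2 * (real p * real m)"
    using c2 m(1) by (auto simp: n_def)
  have lt: "?c / ?S < measure M (C j) / measure M K + 1 / (4 * real p)"
    using y(2) \<open>y \<in> K\<close> S2(1) by (fastforce simp: abs_less_iff)
  have "measure M (C j) / measure M K < 1 / (4 * real p)"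
    using j0 Kpos p by (simp add: j_def field_simps)
  moreover have "1 / real p \<le> ?c / ?S"
  proof -
    have "1 / real p = 2 * real m / (2 * (real p * real m))" using m(1) p by simp
    also have "\<dots> \<le> ?c / ?S" using c2 S2 by (intro frac_le) auto
    finally show ?thesis .
  qed
  ultimately have "1 / real p < 1 / (2 * real p)"
    using lt by (simp add: field_simps)
  then show False using p by (simp add: field_simps)
qed

text \<open>Infinitely many times with a letter other than 1 can yield finitely many points only if
  two of the shifted sequences coincide, which makes \<open>x\<close> periodic.\<close>

lemma orbits_meet_core_infinitely:
  assumes unif: "uniform_partition M T N \<alpha> K"
    and many: "\<And>m. \<exists>g. AE y in M. y \<in> K \<longrightarrow> real m \<le> (\<Sum>t\<in>{- int g..<int g}. indicat_real K (tt t y))"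
    and x: "x \<in> X"
  shows "infinite (full_orbit X left_shift x \<inter> {x' \<in> X. x' 0 \<noteq> 1})"
proof
  assume fin: "finite (full_orbit X left_shift x \<inter> {x' \<in> X. x' 0 \<noteq> 1})"
  let ?s = "\<lambda>k i. x (i + k)"
  have "?s ` {k. x k \<noteq> 1} \<subseteq> full_orbit X left_shift x \<inter> {x' \<in> X. x' 0 \<noteq> 1}"
    using X_shift[OF x] iter_left_shift[OF x] by (force simp: full_orbit_def)
  then have "finite (?s ` {k. x k \<noteq> 1})" using fin by (rule finite_subset)
  then have "\<not> inj_on ?s {k. x k \<noteq> 1}"
    using infinitely_many_non_1[OF many x] finite_imageD by blast
  then obtain k k' where k: "x k \<noteq> 1" "k \<noteq> k'" "?s k = ?s k'"
    by (auto simp: inj_on_def)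
  define a b where "a = min k k'" and "b = max k k'"
  have "a < b" "x a \<noteq> 1" "?s a = ?s b"
    using k fun_cong[OF k(3), of 0] by (auto simp: a_def b_def min_def max_def)
  have "x (i + int (nat (b - a)) + a) = x (i + a)" for i
    using fun_cong[OF \<open>?s a = ?s b\<close>, of i] \<open>a < b\<close> by (simp add: algebra_simps)
  then show False
    using not_periodic[OF unif X_shift[OF x, of a], of "nat (b - a)"] \<open>a < b\<close> \<open>x a \<noteq> 1\<close> by auto
qed

end

text \<open>A window and its translate differ in at most as many times on either side as the length
  of the shift. This is the price of moving a letter other than 1 to time 0.\<close>

lemma sum_shift_window:
  fixes f :: "int \<Rightarrow> real"
  assumes "\<And>t. 0 \<le> f t" "\<And>t. f t \<le> 1"
  shows "\<bar>(\<Sum>t\<in>{u..<v}. f (t + i)) - (\<Sum>t\<in>{u..<v}. f t)\<bar> \<le> 2 * real_of_int \<bar>i\<bar>"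
proof -
  let ?A = "{u + i..<v + i}" and ?B = "{u..<v}"
  have *: "0 \<le> sum f C" "sum f C \<le> real (card C)" if "finite C" for C :: "int set"
    using assms that sum_bounded_above[of C f 1] by (auto intro: sum_nonneg)
  have "(\<Sum>t\<in>{u..<v}. f (t + i)) = sum f ?A"
    by (rule sum.reindex_bij_witness[of _ "\<lambda>t. t - i" "\<lambda>t. t + i"]) auto
  moreover have "sum f ?A = sum f (?A \<inter> ?B) + sum f (?A - ?B)" "sum f ?B = sum f (?A \<inter> ?B) + sum f (?B - ?A)"
    by (subst sum.union_disjoint[symmetric]; auto intro: sum.cong)+
  moreover have "card (?A - ?B) \<le> card {v..<v + i} + card {u + i..<u}"
    by (rule order_trans[OF card_mono card_Un_le]) auto
  then have "real (card (?A - ?B)) \<le> real_of_int \<bar>i\<bar>" by simp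
  moreover have "card (?B - ?A) \<le> card {v + i..<v} + card {u..<u + i}"
    by (rule order_trans[OF card_mono card_Un_le]) auto
  then have "real (card (?B - ?A)) \<le> real_of_int \<bar>i\<bar>" by simp
  ultimately show ?thesis
    using *[of "?A - ?B"] *[of "?B - ?A"] by (simp add: abs_le_iff)
qed

section \<open>The partition\<close>

theorem lemma4p3:
  fixes M :: "'a measure" and T :: "'a \<Rightarrow> 'a"
    and N :: nat and \<alpha>\<^sub>0 :: "nat \<Rightarrow> 'a set" and \<epsilon> :: real
  assumes "infinite_mps M T" and "ergodic_mps M T"
    and "finite_partition M N \<alpha>\<^sub>0"
    and "0 < \<epsilon>" and "\<epsilon> < 1"
  shows "\<exists>\<alpha>. finite_partition M N \<alpha>
           \<and> part_dist M N \<alpha>\<^sub>0 \<alpha> < ennreal \<epsilon>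
           \<and> uniform_partition M T N \<alpha> (fin_core M \<alpha>)
           \<and> (\<forall>x \<in> symbolic_space M T N \<alpha>.
                infinite (full_orbit (symbolic_space M T N \<alpha>) left_shift x
                          \<inter> {x' \<in> symbolic_space M T N \<alpha>. x' 0 \<noteq> 1}))"
proof -
  have inf: "emeasure M (space M) = \<infinity>"
  proof -
    have "emeasure M (\<alpha>\<^sub>0 1) = \<infinity>" using assms(3) by (auto simp: finite_partition_def)
    then show ?thesis using emeasure_space[of M "\<alpha>\<^sub>0 1"] by (simp add: top.extremum_unique)
  qed
  interpret P0: partition_system M T N \<alpha>\<^sub>0
  proof unfold_locales
    show "\<exists>V\<in>sets M. V \<subseteq> W \<and> emeasure M V > 0 \<and> emeasure M (W - V) > 0"
      if "W \<in> sets M" "emeasure M W > 0" for W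
      using assms(1) that by (intro infinite_lebesgue_space_splits) (auto simp: infinite_mps_def)
  qed (use assms inf in \<open>auto simp: infinite_mps_def measure_iso_def\<close>)
  let ?tt = "iter_int (space M) T"
  define l where "l y = itinerary M T N \<alpha>\<^sub>0 y 0" for y
  have l_meas [measurable]: "l \<in> M \<rightarrow>\<^sub>M count_space UNIV"
    unfolding l_def by measurable
  have l_iff: "l y = j \<longleftrightarrow> j \<in> {1..N} \<and> y \<in> \<alpha>\<^sub>0 j" if "y \<in> space M" for y j
    using P0.itin_iff[OF that, of 0 j] by (simp add: l_def)
  have l_range: "l y \<in> {1..N}" if "y \<in> space M" for y
    using l_iff[OF that, of "l y"] by simp
  define K0 where "K0 = fin_core M \<alpha>\<^sub>0"
  have [measurable]: "K0 \<in> sets M" unfolding K0_def by measurable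
  have N2: "2 \<le> N" by (rule P0.N2)
  have K0_l: "y \<in> K0 \<longleftrightarrow> l y \<noteq> 1" if "y \<in> space M" for y
    using P0.itin_neq_1[OF that, of 0] by (simp add: l_def K0_def)
  have K0_pos: "0 < emeasure M K0" and K0_fin: "emeasure M K0 < \<infinity>"
    unfolding K0_def by (rule P0.K_pos P0.K_fin)+
  have fin: "emeasure M B \<noteq> \<infinity>" "emeasure M B < \<infinity>" if "B \<subseteq> K0" for B
    using emeasure_mono[OF that, of M] K0_fin by auto
  have \<alpha>K0: "\<alpha>\<^sub>0 j \<subseteq> K0" if "j \<in> {1..N} - {1}" for j
    using that unfolding K0_def P0.fin_core_UN by blast

  \<comment> \<open>The bound by \<epsilon> gives the distance, since each of the fewer than
    \<open>N\<close> finite atoms loses at most \<eta>. The bound by the atoms of positive measure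
    ensures that none of them is erased completely.\<close>
  obtain \<eta> where \<eta>: "0 < \<eta>" "\<eta> < measure M K0" "real N * \<eta> < \<epsilon>"
    "\<And>j. j \<in> {1..N} - {1} \<Longrightarrow> 0 < measure M (\<alpha>\<^sub>0 j) \<Longrightarrow> \<eta> < measure M (\<alpha>\<^sub>0 j)"
  proof -
    define S where "S = insert (measure M K0) (insert (\<epsilon> / N) (measure M ` {j \<in> \<alpha>\<^sub>0 ` ({1..N} - {1}). 0 < measure M j}))"
    have S: "finite S" "S \<noteq> {}" unfolding S_def by auto
    have "0 < s" if "s \<in> S" for s
      using that K0_pos K0_fin assms(4) N2 by (auto simp: S_def measure_def enn2real_positive_iff)
    then have "0 < Min S" using S by simp
    then obtain \<eta> where "0 < \<eta>" "\<eta> < Min S" using dense by blast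
    then have less: "\<eta> < s" if "s \<in> S" for s
      using Min_le[OF S(1) that] by linarith
    have "\<eta> < measure M K0" "\<eta> < \<epsilon> / N"
      "\<And>j. j \<in> {1..N} - {1} \<Longrightarrow> 0 < measure M (\<alpha>\<^sub>0 j) \<Longrightarrow> \<eta> < measure M (\<alpha>\<^sub>0 j)"
      using less unfolding S_def by blast+
    with \<open>0 < \<eta>\<close> show thesis
      using N2 by (intro that[of \<eta>]) (auto simp: field_simps)
  qed
  obtain A where A [measurable]: "A \<in> sets M" and AK0: "A \<subseteq> K0" and smallA: "measure M (K0 - A) \<le> \<eta>"
    and posA: "0 < measure M A"
    and many: "\<forall>m. \<exists>g. \<forall>y\<in>A. real m \<le> (\<Sum>t\<in>{- int g..<int g}. indicat_real A (?tt t y))"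
    and core: "\<forall>I a e. finite I \<longrightarrow> 0 \<in> I \<longrightarrow> a 0 \<noteq> 1 \<longrightarrow> 0 < e \<longrightarrow>
      (\<exists>m>0. \<forall>y\<in>space M. \<forall>u v. real m \<le> (\<Sum>t\<in>{u..<v}. indicat_real A (?tt t y)) \<longrightarrow>
        \<bar>(\<Sum>t\<in>{u..<v}. indicat_real (P0.cyl l A I a) (?tt t y)) -
          measure M (P0.cyl l A I a) / measure M A * (\<Sum>t\<in>{u..<v}. indicat_real A (?tt t y))\<bar>
        \<le> e * (\<Sum>t\<in>{u..<v}. indicat_real A (?tt t y)))"
    by (rule bexE, rule P0.ex_uniform_core[OF l_meas _ \<open>K0 \<in> sets M\<close> K0_fin \<eta>(1,2)],
        erule l_range, (erule conjE)+, rule that)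

  text \<open>
    The atoms of \<open>\<alpha>\<^sub>0\<close> of measure zero are restored, because every atom of \<open>\<alpha>\<close> has to be nonempty.
  \<close>
  define Z where "Z = (\<Union>j\<in>{j \<in> {1..N} - {1}. emeasure M (\<alpha>\<^sub>0 j) = 0}. \<alpha>\<^sub>0 j)"
  define K where "K = A \<union> Z"
  define \<alpha> where "\<alpha> j = (if j = 1 then space M - K else \<alpha>\<^sub>0 j \<inter> K)" for j
  have Znull: "Z \<in> null_sets M"
    unfolding Z_def by (intro null_sets_UN') (auto intro: countable_finite)
  then have [measurable]: "Z \<in> sets M" by auto
  have [measurable]: "K \<in> sets M" unfolding K_def by measurable
  have KK0: "K \<subseteq> K0" using AK0 \<alpha>K0 by (auto simp: K_def Z_def)
  have Ksp: "K \<subseteq> space M" by (rule sets.sets_into_space) measurable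
  have small: "emeasure M (K0 - K) \<le> ennreal \<eta>"
  proof -
    have "emeasure M (K0 - K) \<le> emeasure M (K0 - A)" by (intro emeasure_mono) (auto simp: K_def)
    also have "\<dots> = ennreal (measure M (K0 - A))" using fin by (intro emeasure_eq_ennreal_measure) auto
    finally show ?thesis using smallA by (meson ennreal_leI order_trans)
  qed
  have core_eq: "fin_core M \<alpha> = K" using Ksp by (auto simp: fin_core_def \<alpha>_def)
  have Kpos: "0 < emeasure M K"
  proof -
    have "0 < emeasure M A" using posA by (auto simp: measure_def zero_less_iff_neq_zero)
    also have "\<dots> \<le> emeasure M K" by (intro emeasure_mono) (auto simp: K_def)
    finally show ?thesis .
  qed
  have inf1: "emeasure M (space M - K) = \<infinity>"
    using inf fin[OF KK0] by (subst emeasure_compl) auto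
  have fp: "finite_partition M N \<alpha>"
    unfolding finite_partition_def core_eq
  proof (intro conjI ballI)
    fix j assume j: "j \<in> {1..N}"
    show "\<alpha> j \<in> sets M" using j by (auto simp: \<alpha>_def)
    show "\<alpha> j \<noteq> {}"
    proof (cases "j = 1")
      case True
      have "emeasure M {} \<noteq> \<infinity>" by simp
      then have "space M - K \<noteq> {}" using inf1 by metis
      then show ?thesis using True by (simp add: \<alpha>_def)
    next
      case False
      then have j': "j \<in> {1..N} - {1}" using j by auto
      show ?thesis
      proof (cases "emeasure M (\<alpha>\<^sub>0 j) = 0")
        case True
        then have "\<alpha>\<^sub>0 j \<subseteq> K" using j' by (auto simp: K_def Z_def)
        then have "\<alpha> j = \<alpha>\<^sub>0 j" using False by (auto simp: \<alpha>_def)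
        then show ?thesis using assms(3) j unfolding finite_partition_def by simp
      next
        case nz: False
        show ?thesis
        proof
          assume "\<alpha> j = {}"
          then have "\<alpha>\<^sub>0 j \<subseteq> K0 - K" using False \<alpha>K0[OF j'] by (auto simp: \<alpha>_def)
          then have "emeasure M (\<alpha>\<^sub>0 j) \<le> emeasure M (K0 - K)" by (intro emeasure_mono) auto
          then have "emeasure M (\<alpha>\<^sub>0 j) \<le> ennreal \<eta>" using small by simp
          moreover have "emeasure M (\<alpha>\<^sub>0 j) = ennreal (measure M (\<alpha>\<^sub>0 j))"
            using fin[OF \<alpha>K0[OF j']] by (intro emeasure_eq_ennreal_measure) auto
          ultimately have "measure M (\<alpha>\<^sub>0 j) \<le> \<eta>" "0 < measure M (\<alpha>\<^sub>0 j)"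
            using \<eta>(1) nz by (auto simp: zero_less_measure_iff)
          then show False using \<eta>(4)[OF j'] by simp
        qed
      qed
    qed
  next
    have disj: "disjoint_family_on \<alpha>\<^sub>0 {1..N}" and un: "(\<Union>i\<in>{1..N}. \<alpha>\<^sub>0 i) = space M"
      using assms(3) unfolding finite_partition_def by blast+
    show "disjoint_family_on \<alpha> {1..N}"
      unfolding disjoint_family_on_def
    proof (intro ballI impI)
      fix i j assume "i \<in> {1..N}" "j \<in> {1..N}" "i \<noteq> j"
      then show "\<alpha> i \<inter> \<alpha> j = {}"
        using disjoint_family_onD[OF disj, of i j] by (auto simp: \<alpha>_def)
    qed
    show "(\<Union>i\<in>{1..N}. \<alpha> i) = space M"
    proof -
      have "K = (\<Union>j\<in>{1..N} - {1}. \<alpha> j)"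
        using KK0 unfolding K0_def P0.fin_core_UN by (auto simp: \<alpha>_def)
      moreover have "{1..N} = insert 1 ({1..N} - {1})" using N2 by auto
      then have "(\<Union>i\<in>{1..N}. \<alpha> i) = \<alpha> 1 \<union> (\<Union>j\<in>{1..N} - {1}. \<alpha> j)" by (metis UN_insert)
      ultimately show ?thesis using Ksp by (auto simp: \<alpha>_def)
    qed
    show "emeasure M (\<alpha> 1) = \<infinity>" using inf1 by (simp add: \<alpha>_def)
    show "emeasure M (\<alpha> j) < \<infinity>" if "j \<in> {1..N} - {1}" for j
      using fin[of "\<alpha> j"] KK0 that by (auto simp: \<alpha>_def)
  qed (use N2 Kpos in auto)

  have dist: "part_dist M N \<alpha>\<^sub>0 \<alpha> < ennreal \<epsilon>"
  proof -
    have "part_dist M N \<alpha>\<^sub>0 \<alpha> \<le> (\<Sum>i\<in>{1..N} - {1}. ennreal \<eta>)"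
      unfolding part_dist_def
    proof (rule sum_mono)
      fix j assume j: "j \<in> {1..N} - {1}"
      have "emeasure M (sym_diff (\<alpha>\<^sub>0 j) (\<alpha> j)) \<le> emeasure M (K0 - K)"
        using \<alpha>K0[OF j] j by (intro emeasure_mono) (auto simp: \<alpha>_def)
      then show "emeasure M (sym_diff (\<alpha>\<^sub>0 j) (\<alpha> j)) \<le> ennreal \<eta>" using small by (rule order_trans)
    qed
    also have "\<dots> = ennreal (real (N - 1) * \<eta>)"
      using N2 \<eta>(1) by (simp add: ennreal_mult ennreal_of_nat_eq_real_of_nat)
    also have "\<dots> < ennreal \<epsilon>"
    proof (rule ennreal_lessI[OF assms(4)])
      have "real (N - 1) * \<eta> \<le> real N * \<eta>" using \<eta>(1) by (intro mult_right_mono) auto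
      then show "real (N - 1) * \<eta> < \<epsilon>" using \<eta>(3) by simp
    qed
    finally show ?thesis .
  qed

  interpret P: partition_system M T N \<alpha>
    by unfold_locales (rule fp)

  \<comment> \<open>Restoring \<open>Z\<close> turns statements about all points of \<open>A\<close>
    into statements about almost all points of \<open>K\<close>: almost no orbit ever meets the null
    set \<open>Z\<close>.\<close>
  have AE_KA: "AE y in M. \<forall>i. ?tt i y \<in> K \<longleftrightarrow> ?tt i y \<in> A"
    using AE_not_in[OF Znull] by (intro P0.AE_tt) (auto simp: K_def)
  have label: "?tt i y \<in> \<alpha> j \<longleftrightarrow> (if ?tt i y \<in> K then l (?tt i y) else 1) = j"
    if y: "y \<in> space M" and j: "j \<in> {1..N}" for y i j
    using l_iff[OF P0.tt_space[OF y], of i j] K0_l[OF P0.tt_space[OF y], of i] KK0 j y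
    by (auto simp: \<alpha>_def)
  have mKA: "measure M K = measure M A"
    using AE_KA by (intro measure_eq_AE) (auto elim!: eventually_mono dest: spec[of _ 0])

  have many': "\<exists>g. AE y in M. y \<in> fin_core M \<alpha> \<longrightarrow>
    real m \<le> (\<Sum>t\<in>{- int g..<int g}. indicat_real (fin_core M \<alpha>) (?tt t y))" for m
  proof -
    obtain g where g: "\<And>y. y \<in> A \<Longrightarrow> real m \<le> (\<Sum>t\<in>{- int g..<int g}. indicat_real A (?tt t y))"
      using many by blast
    have "AE y in M. y \<in> K \<longrightarrow> real m \<le> (\<Sum>t\<in>{- int g..<int g}. indicat_real K (?tt t y))"
      using AE_KA
    proof eventually_elim
      case (elim y)
      then have "indicat_real K (?tt t y) = indicat_real A (?tt t y)" for t by (simp add: indicator_def)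
      moreover have "y \<in> K \<longleftrightarrow> y \<in> A" using spec[OF elim, of 0] by simp
      ultimately show ?case using g by simp
    qed
    then show ?thesis unfolding core_eq by blast
  qed

  have unif: "uniform_partition M T N \<alpha> (fin_core M \<alpha>)"
    unfolding uniform_partition_def core_eq
  proof (intro allI impI ballI)
    fix n C assume n: "1 \<le> n" and C: "C \<in> part_join M T N \<alpha> (- int n) (int n - 1)"
      and Cpf: "C \<in> pos_fin_sets M"
    let ?J = "{- int n..int n - 1}"
    have [measurable]: "C \<in> sets M" using Cpf by (auto simp: pos_fin_sets_def)
    obtain B where B: "C = (\<Inter>i\<in>?J. ?tt i -` B i \<inter> space M)" "\<forall>i\<in>?J. B i \<in> \<alpha> ` {1..N}"
      using C unfolding part_join_def by blast
    then have "\<forall>i\<in>?J. \<exists>j. j \<in> {1..N} \<and> B i = \<alpha> j" by blast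
    then obtain b where b: "\<And>i. i \<in> ?J \<Longrightarrow> b i \<in> {1..N}" "\<And>i. i \<in> ?J \<Longrightarrow> B i = \<alpha> (b i)"
      using bchoice[of ?J "\<lambda>i j. j \<in> {1..N} \<and> B i = \<alpha> j"] by blast
    have "0 \<in> ?J" using n by simp
    then have C_iff: "y \<in> C \<longleftrightarrow> y \<in> space M \<and> (\<forall>i\<in>?J. ?tt i y \<in> \<alpha> (b i))" for y
      unfolding B(1) using b(2) by auto
    \<comment> \<open>If all letters were 1, then \<open>C\<close> and finitely many translates of
      \<open>K\<close> would cover the space, so \<open>C\<close> would have infinite
      measure.\<close>
    obtain i0 where i0: "i0 \<in> ?J" "b i0 \<noteq> 1"
    proof (rule ccontr)
      assume "\<not> thesis"
      then have b1: "\<And>i. i \<in> ?J \<Longrightarrow> b i = 1" using that by blast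
      have "space M \<subseteq> C \<union> (\<Union>i\<in>?J. ?tt i -` K \<inter> space M)"
        using b1 by (auto simp: C_iff \<alpha>_def)
      then have "emeasure M (space M) \<le> emeasure M (C \<union> (\<Union>i\<in>?J. ?tt i -` K \<inter> space M))"
        by (intro emeasure_mono) auto
      also have "\<dots> \<le> emeasure M C + emeasure M (\<Union>i\<in>?J. ?tt i -` K \<inter> space M)"
        by (intro emeasure_subadditive) auto
      also have "\<dots> \<le> emeasure M C + (\<Sum>i\<in>?J. emeasure M (?tt i -` K \<inter> space M))"
        by (intro add_left_mono emeasure_subadditive_finite) auto
      also have "\<dots> < \<infinity>"
        using fin[OF KK0] Cpf
        by (simp add: P0.tt_preserve ennreal_mult_less_top of_nat_less_top pos_fin_sets_def)
      finally show False using inf by simp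
    qed
    \<comment> \<open>The word is recentred at \<open>i0\<close>, where its letter is not 1, to
      match the cylinders treated by \<open>core\<close>; almost everywhere \<open>C\<close> is then
      the preimage of \<open>C'\<close> under \<open>tt i0\<close>.\<close>
    define I where "I = (\<lambda>i. i - i0) ` ?J"
    define a where "a i = b (i + i0)" for i
    define C' where "C' = P0.cyl l A I a"
    have [measurable]: "C' \<in> sets M" unfolding C'_def by measurable
    have CC': "?tt t y \<in> C \<longleftrightarrow> ?tt (t + i0) y \<in> C'"
      if y: "y \<in> space M" and KA: "\<forall>i. ?tt i y \<in> K \<longleftrightarrow> ?tt i y \<in> A" for t y
    proof -
      have "?tt t y \<in> C \<longleftrightarrow> (\<forall>i\<in>?J. ?tt (i + t) y \<in> \<alpha> (b i))"
        using y by (simp add: C_iff P0.tt_add)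
      also have "\<dots> \<longleftrightarrow> (\<forall>i\<in>?J. (if ?tt (i + t) y \<in> A then l (?tt (i + t) y) else 1) = b i)"
        using label[OF y b(1)] KA by (intro ball_cong) auto
      also have "\<dots> \<longleftrightarrow> (\<forall>i\<in>I. (if ?tt (i + i0 + t) y \<in> A then l (?tt (i + i0 + t) y) else 1) = a i)"
        by (simp only: I_def a_def ball_simps(9) diff_add_cancel)
      also have "\<dots> \<longleftrightarrow> ?tt (t + i0) y \<in> C'"
        using y by (simp add: C'_def P0.cyl_def P0.tt_add[symmetric] ac_simps)
      finally show ?thesis .
    qed
    have "AE y in M. y \<in> C \<longleftrightarrow> y \<in> ?tt i0 -` C' \<inter> space M"
      using AE_KA AE_space
    proof eventually_elim
      case (elim y)
      then show ?case using CC'[OF elim(2,1), of 0] by simp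
    qed
    then have "emeasure M C = emeasure M (?tt i0 -` C' \<inter> space M)"
      by (intro emeasure_eq_AE) auto
    also have "\<dots> = emeasure M C'" by (rule P0.tt_preserve) measurable
    finally have mC: "measure M C = measure M C'" by (simp add: measure_def)
    show "uniform_set M T K C"
      unfolding uniform_set_def
    proof (intro conjI allI impI)
      show "K \<in> pos_fin_sets M" using Kpos fin[OF KK0] by (auto simp: pos_fin_sets_def)
      show "C \<in> pos_fin_sets M" by (rule Cpf)
      fix e :: real assume e: "0 < e"
      have "finite I" "0 \<in> I" "a 0 \<noteq> 1" using i0 by (auto simp: I_def a_def)
      then obtain m0 where m0: "\<And>y u v. y \<in> space M \<Longrightarrow>
        real m0 \<le> (\<Sum>t\<in>{u..<v}. indicat_real A (?tt t y)) \<Longrightarrow>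
        \<bar>(\<Sum>t\<in>{u..<v}. indicat_real C' (?tt t y)) -
          measure M C' / measure M A * (\<Sum>t\<in>{u..<v}. indicat_real A (?tt t y))\<bar>
        \<le> e / 4 * (\<Sum>t\<in>{u..<v}. indicat_real A (?tt t y))"
        using core[rule_format, of I a "e / 4"] e unfolding C'_def by auto
      \<comment> \<open>This makes the cost of the shift by \<open>i0\<close> at most
        \<open>e / 4\<close> per visit. Together with the \<open>e / 4\<close> from
        \<open>core\<close> the error is \<open>e / 2\<close>, which leaves room for the strict
        inequality.\<close>
      obtain m1 :: nat where m1: "8 * real_of_int \<bar>i0\<bar> / e \<le> real m1" using real_arch_simple by blast
      define m where "m = Suc (m0 + m1)"
      have "AE y in M. y \<in> K \<longrightarrow> (\<forall>n. birkhoff_sum M T n (indicator K) y \<ge> real m \<longrightarrow>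
         \<bar>birkhoff_sum M T n (indicator C) y / birkhoff_sum M T n (indicator K) y
           - measure M C / measure M K\<bar> < e)"
        using AE_KA AE_space
      proof eventually_elim
        case (elim y)
        show ?case
        proof (intro impI allI)
          fix n assume ge: "birkhoff_sum M T n (indicator K) y \<ge> real m"
          let ?W = "{- int n..<int n}"
          have W: "{- int n..int n - 1} = ?W" by auto
          define S where "S = (\<Sum>t\<in>?W. indicat_real A (?tt t y))"
          define c where "c = (\<Sum>t\<in>?W. indicat_real C' (?tt (t + i0) y))"
          have Sb: "birkhoff_sum M T n (indicator K) y = S"
            unfolding birkhoff_sum_def S_def W using elim(1) by (intro sum.cong) (auto simp: indicator_def)
          have cb: "birkhoff_sum M T n (indicator C) y = c"
            unfolding birkhoff_sum_def c_def W using CC'[OF elim(2,1)] by (intro sum.cong) (auto simp: indicator_def)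
          have S: "real m \<le> S" using ge Sb by simp
          then have Spos: "0 < S" and Sm0: "real m0 \<le> S" and Sm1: "8 * real_of_int \<bar>i0\<bar> / e \<le> S"
            using m1 by (auto simp: m_def)
          have "\<bar>(\<Sum>t\<in>?W. indicat_real C' (?tt t y)) - measure M C' / measure M A * S\<bar> \<le> e / 4 * S"
            using m0[OF elim(2)] Sm0 unfolding S_def by blast
          moreover have "\<bar>c - (\<Sum>t\<in>?W. indicat_real C' (?tt t y))\<bar> \<le> 2 * real_of_int \<bar>i0\<bar>"
            unfolding c_def by (rule sum_shift_window) (auto simp: indicator_def)
          moreover have "2 * real_of_int \<bar>i0\<bar> \<le> e / 4 * S"
            using Sm1 e by (simp add: field_simps)
          moreover have "\<bar>c - b\<bar> \<le> r + r" if "\<bar>a - b\<bar> \<le> r" "\<bar>c - a\<bar> \<le> q" "q \<le> r" for a b q r :: real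
            using that by linarith
          ultimately have "\<bar>c - measure M C' / measure M A * S\<bar> \<le> e / 4 * S + e / 4 * S"
            by metis
          also have "\<dots> < e * S" using e Spos by simp
          finally have "\<bar>c - measure M C' / measure M A * S\<bar> / S < e"
            using Spos by (simp add: pos_divide_less_eq)
          moreover have "\<bar>c - measure M C' / measure M A * S\<bar> / S = \<bar>c / S - measure M C' / measure M A\<bar>"
          proof -
            have "c / S - measure M C' / measure M A = (c - measure M C' / measure M A * S) / S"
              using Spos by (simp add: diff_divide_distrib)
            then show ?thesis using Spos by simp
          qed
          ultimately show "\<bar>birkhoff_sum M T n (indicator C) y / birkhoff_sum M T n (indicator K) y
            - measure M C / measure M K\<bar> < e"
            unfolding Sb cb mC mKA by simp
        qed
      qed
      then show "\<exists>m>0. AE y in M. y \<in> K \<longrightarrow> (\<forall>n. birkhoff_sum M T n (indicator K) y \<ge> real m \<longrightarrow>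
         \<bar>birkhoff_sum M T n (indicator C) y / birkhoff_sum M T n (indicator K) y
           - measure M C / measure M K\<bar> < e)"
        by (intro exI[of _ m]) (auto simp: m_def)
    qed
  qed

  show ?thesis
    using fp dist unif P.orbits_meet_core_infinitely[OF unif many'] by blast
qed

end
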